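(* For every $\alpha\in(0,1]$ there are positive constants $C_\alpha,C'_\alpha$ depending only on $\alpha$ such that the following holds. Let $d\in\mathbb{N}$, $d\ge2$, and $\alpha\in(0,1]$. Then there is $\varepsilon_0=\varepsilon_0(d,\alpha)\in(0,1/2]$ such that for every $\varepsilon\in(0,\varepsilon_0)$ and for every $f\in\mathring{U}^{\alpha,d}_\infty$ one can explicitly construct an adaptive deep ReLU neural network $\Phi_\varepsilon(f)$ (i.e. its architecture may depend on $f$) so that $$\|f-\Phi_\varepsilon(f)\|_\infty\le\varepsilon .$$ Moreover, $$W(\Phi_\varepsilon(f))\le C_\alpha\, d^2\left(\frac{K_2^d}{(d-1)!}\right)^{\frac2\alpha+2}\varepsilon^{-\frac1\alpha}\,\big(\log(2\varepsilon^{-1})\,\log\log(2\varepsilon^{-1})\big)^{(1+\frac1\alpha)(d-1)}$$ and $$L(\Phi_\varepsilon(f))\le C'_\alpha\,\varepsilon^{-\frac{1}{d\alpha}}\,\big(\log(2\varepsilon^{-1})\big)^{\frac{d-1-\alpha}{d\alpha}}\,\big(\log\log(2\varepsilon^{-1})\big)^{\frac{(\alpha+1)(d-1)}{d\alpha}},$$ where $$K_2:=4\,(2^{\alpha+3}B)^{\frac{1}{2\alpha+2}}\,\big(\alpha^{-1}\log(2\alpha^{-1})\big)^{1/2},\qquad B=(2^\alpha-1)^{-1}.$$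
   Context: Notation: $\mathbb{I}=[0,1]$, $\mathbb{I}^d=[0,1]^d$, $\|\cdot\|_\infty$ is the norm of $L_\infty(\mathbb{I}^d)$, $\log$ is the logarithm to base 2. Function class. For $u\subset\{1,\dots,d\}$ and $\boldsymbol h=(h_1,\dots,h_d)$ with positive entries, $\Delta_{\boldsymbol h,u}:=\prod_{i\in u}\Delta_{h_i}$, $\Delta_{\boldsymbol h,\varnothing}:=\mathrm{Id}$, where $\Delta_{h_i}$ is the first difference $g\mapsto g(\cdot+h_i)-g(\cdot)$ applied in the variable $x_i$ with the other variables fixed. For $0<\alpha\le1$ and $f\in C(\mathbb{I}^d)$ put $$|f|_{H^\alpha_\infty(u)}:=\sup_{\boldsymbol h>0}\ \prod_{i\in u}h_i^{-\alpha}\,\|\Delta_{\boldsymbol h,u}(f)\|_{C(\mathbb{I}^d(\boldsymbol h,u))},\qquad \mathbb{I}^d(\boldsymbol h,u):=\{\boldsymbol x\in\mathbb{I}^d:\ x_i+h_i\in\mathbb{I},\ i\in u\}$$ (the sup norm over an empty set is $0$; $|f|_{H^\alpha_\infty(\varnothing)}=\|f\|_{C(\mathbb{I}^d)}$). $H^\alpha_\infty(\mathbb{I}^d)$ is the set of $f\in C(\mathbb{I}^d)$ with finite norm $\|f\|_{H^\alpha_\infty(\mathbb{I}^d)}:=\max_{u\subset\{1,\dots,d\}}|f|_{H^\alpha_\infty(u)}$. $\mathring{C}(\mathbb{I}^d)$ is the set of $f\in C(\mathbb{I}^d)$ vanishing on the boundary of $\mathbb{I}^d$. $\mathring{U}^{\alpha,d}_\infty$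 is the set of $f\in H^\alpha_\infty(\mathbb{I}^d)\cap\mathring{C}(\mathbb{I}^d)$ with $\|f\|_{H^\alpha_\infty(\mathbb{I}^d)}\le1$. Neural networks. A neural network with input dimension $d$ and $L\ge2$ layers is a sequence $\Phi=((\boldsymbol W^1,\boldsymbol b^1),\dots,(\boldsymbol W^L,\boldsymbol b^L))$, where $\boldsymbol W^\ell$ is a real $N_\ell\times N_{\ell-1}$ matrix, $\boldsymbol b^\ell\in\mathbb{R}^{N_\ell}$, $N_0=d$, $N_1,\dots,N_L\in\mathbb{N}$. Its depth is $L(\Phi)=L$ and its size $W(\Phi)$ is the number of nonzero entries of all $\boldsymbol W^\ell$ and $\boldsymbol b^\ell$. It is called deep if $L(\Phi)\ge3$. A (deep) ReLU neural network computes, with $\sigma(t)=\max\{t,0\}$ applied coordinatewise, $\boldsymbol z^0=\boldsymbol x\in\mathbb{R}^d$, $\boldsymbol z^\ell=\sigma(\boldsymbol W^\ell\boldsymbol z^{\ell-1}+\boldsymbol b^\ell)$ for $\ell=1,\dots,L-1$, and $\boldsymbol z^L=\boldsymbol W^L\boldsymbol z^{L-1}+\boldsymbol b^L$; the output is $\Phi(\boldsymbol x):=\boldsymbol z^L$, and a network is identified with its output function. *)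

theory Defs
  imports "HOL-Probability.Essential_Supremum" "Jordan_Normal_Form.Matrix"
begin

text \<open>
  The dimension is quantified inside the statement, so points of \<open>\<real>\<^sup>d\<close> are extensional functions on
  \<open>{..<d}\<close>; variables are numbered from 0. Functions on the cube are total functions of which only
  the values on the cube matter. On extensional functions the product topology of
  \<^typ>\<open>nat \<Rightarrow> real\<close> induces the topology of \<open>\<real>\<^sup>d\<close>.
\<close>

definition unit_cube :: "nat \<Rightarrow> (nat \<Rightarrow> real) set" where
  "unit_cube d = (\<Pi>\<^sub>E i\<in>{..<d}. {0..1})"

text \<open>The topological frontier in \<^typ>\<open>nat \<Rightarrow> real\<close> would be the whole cube, hence the
  explicit description of the boundary.\<close>

definition unit_cube_boundary :: "nat \<Rightarrow> (nat \<Rightarrow> real) set" where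
  "unit_cube_boundary d = {x \<in> unit_cube d. \<exists>i<d. x i = 0 \<or> x i = 1}"

definition cube_measure :: "nat \<Rightarrow> (nat \<Rightarrow> real) measure" where
  "cube_measure d = (\<Pi>\<^sub>M i\<in>{..<d}. restrict_space lborel {0..1})"

definition Linf_norm :: "nat \<Rightarrow> ((nat \<Rightarrow> real) \<Rightarrow> real) \<Rightarrow> ennreal" where
  "Linf_norm d g = esssup (cube_measure d) (\<lambda>x. ennreal \<bar>g x\<bar>)"

subsection \<open>Mixed Hoelder spaces\<close>

definition diff1 :: "nat \<Rightarrow> real \<Rightarrow> ((nat \<Rightarrow> real) \<Rightarrow> real) \<Rightarrow> (nat \<Rightarrow> real) \<Rightarrow> real" where
  "diff1 i t g = (\<lambda>x. g (x(i := x i + t)) - g x)"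

lemma diff1_commute: "diff1 i s (diff1 j t g) = diff1 j t (diff1 i s g)"
  by (cases "i = j") (auto simp: diff1_def fun_upd_twist algebra_simps)

text \<open>The order in which the factors are composed is irrelevant by the previous lemma.\<close>

definition mixed_diff ::
    "(nat \<Rightarrow> real) \<Rightarrow> nat set \<Rightarrow> ((nat \<Rightarrow> real) \<Rightarrow> real) \<Rightarrow> (nat \<Rightarrow> real) \<Rightarrow> real" where
  "mixed_diff h u g = fold (\<lambda>i. diff1 i (h i)) (sorted_list_of_set u) g"

definition shift_cube :: "nat \<Rightarrow> (nat \<Rightarrow> real) \<Rightarrow> nat set \<Rightarrow> (nat \<Rightarrow> real) set" where
  "shift_cube d h u = {x \<in> unit_cube d. \<forall>i\<in>u. x i + h i \<in> {0..1}}"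

text \<open>Suprema are taken in \<^typ>\<open>ennreal\<close>, where the supremum of the empty set is 0.\<close>

definition holder_seminorm ::
    "real \<Rightarrow> nat \<Rightarrow> nat set \<Rightarrow> ((nat \<Rightarrow> real) \<Rightarrow> real) \<Rightarrow> ennreal" where
  "holder_seminorm \<alpha> d u f =
     (SUP h\<in>{h. \<forall>i<d. 0 < h i}.
        ennreal (\<Prod>i\<in>u. h i powr (- \<alpha>)) *
        (SUP x\<in>shift_cube d h u. ennreal \<bar>mixed_diff h u f x\<bar>))"

definition holder_norm :: "real \<Rightarrow> nat \<Rightarrow> ((nat \<Rightarrow> real) \<Rightarrow> real) \<Rightarrow> ennreal" where
  "holder_norm \<alpha> d f = Max ((\<lambda>u. holder_seminorm \<alpha> d u f) ` Pow {..<d})"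

definition holder_space :: "real \<Rightarrow> nat \<Rightarrow> ((nat \<Rightarrow> real) \<Rightarrow> real) set" where
  "holder_space \<alpha> d = {f. continuous_on (unit_cube d) f \<and> holder_norm \<alpha> d f < \<infinity>}"

definition cont_zero_boundary :: "nat \<Rightarrow> ((nat \<Rightarrow> real) \<Rightarrow> real) set" where
  "cont_zero_boundary d =
     {f. continuous_on (unit_cube d) f \<and> (\<forall>x\<in>unit_cube_boundary d. f x = 0)}"

definition holder_ball0 :: "real \<Rightarrow> nat \<Rightarrow> ((nat \<Rightarrow> real) \<Rightarrow> real) set" where
  "holder_ball0 \<alpha> d =
     {f \<in> holder_space \<alpha> d \<inter> cont_zero_boundary d. holder_norm \<alpha> d f \<le> 1}"

subsection \<open>ReLU neural networks\<close>

type_synonym network = "(real mat \<times> real vec) list"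

definition net_depth :: "network \<Rightarrow> nat" where
  "net_depth \<Phi> = length \<Phi>"

text \<open>\<open>\<Phi> ! l\<close> is the layer number \<open>l + 1\<close>, and \<open>N\<close> lists the layer widths.\<close>

definition is_network :: "nat \<Rightarrow> nat \<Rightarrow> network \<Rightarrow> bool" where
  "is_network d m \<Phi> \<longleftrightarrow> net_depth \<Phi> \<ge> 2 \<and>
     (\<exists>N :: nat \<Rightarrow> nat. N 0 = d \<and> N (net_depth \<Phi>) = m \<and>
        (\<forall>l<net_depth \<Phi>. N (Suc l) \<ge> 1 \<and>
           fst (\<Phi> ! l) \<in> carrier_mat (N (Suc l)) (N l) \<and>
           snd (\<Phi> ! l) \<in> carrier_vec (N (Suc l))))"

definition net_deep :: "network \<Rightarrow> bool" where
  "net_deep \<Phi> \<longleftrightarrow> net_depth \<Phi> \<ge> 3"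

definition net_size :: "network \<Rightarrow> nat" where
  "net_size \<Phi> = (\<Sum>(W, b)\<leftarrow>\<Phi>.
     card {(i, j). i < dim_row W \<and> j < dim_col W \<and> W $$ (i, j) \<noteq> 0} +
     card {i. i < dim_vec b \<and> b $ i \<noteq> 0})"

definition relu :: "real \<Rightarrow> real" where
  "relu t = max t 0"

fun net_eval :: "network \<Rightarrow> real vec \<Rightarrow> real vec" where
  "net_eval [] z = z"
| "net_eval [(W, b)] z = W *\<^sub>v z + b"
| "net_eval ((W, b) # l # \<Phi>) z = net_eval (l # \<Phi>) (map_vec relu (W *\<^sub>v z + b))"

definition net_fun :: "nat \<Rightarrow> network \<Rightarrow> (nat \<Rightarrow> real) \<Rightarrow> real" where
  "net_fun d \<Phi> x = net_eval \<Phi> (Matrix.vec d x) $ 0"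

subsection \<open>Constants of the size bound\<close>

definition B_const :: "real \<Rightarrow> real" where
  "B_const \<alpha> = inverse (2 powr \<alpha> - 1)"

definition K2_const :: "real \<Rightarrow> real" where
  "K2_const \<alpha> = 4 * (2 powr (\<alpha> + 3) * B_const \<alpha>) powr (1 / (2 * \<alpha> + 2)) *
     (inverse \<alpha> * log 2 (2 * inverse \<alpha>)) powr (1 / 2)"

end

theory Submission
  imports Defs "HOL-Real_Asymp.Real_Asymp"
begin

text \<open>
  A function with bounded mixed differences that vanishes on the boundary is approximated by its
  hierarchical (Faber) expansion on a sparse grid: truncating at total level \<open>n\<close> leaves an error
  \<open>2 powr (- \<alpha> n) * (n + 1) ^ (d - 1)\<close> and at most \<open>2 ^ n * (n + 1) ^ (d - 1)\<close> tensor product hats.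
  The hats of one multi-level have disjoint supports, so on its support a tensor hat agrees with the
  product of the \<open>d\<close> sawtooth functions of that level. This product is computed once per level,
  with squares replaced by piecewise linear interpolants with about \<open>2 powr (3 n / 4)\<close> knots, and
  a single further ReLU cuts out each tensor hat exactly. Thus the size is
  \<open>O(2 ^ n * (n + 1) ^ (d - 1))\<close> and the depth depends on \<open>d\<close> only. For \<open>n\<close> chosen
  minimal for accuracy \<open>\<epsilon>\<close> this gives the size bound without the iterated logarithm,
  which in turn absorbs every constant depending on \<open>d\<close> and \<open>\<alpha>\<close>; so \<open>C = C' = 1\<close> is possible.
\<close>

subsection \<open>Hat functions and sparse grids\<close>

text \<open>The obstacle is the accumulation of product errors. There are more than
  \<open>2 ^ n\<close> tensor hats up to powers of \<open>n\<close>; if an error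
  \<open>1 / N ^ 2\<close> in each of them counted, \<open>N\<close> would have to be about
  \<open>2 ^ n\<close>, too many knots for one square per level list. Since the rectifier makes an
  approximate tensor hat exactly zero wherever the true one vanishes, at most \<open>n ^ d\<close>
  errors meet at a point. This is why products are approximated from below. The exponent 3/4 meets
  two demands: the knots for \<open>n ^ d\<close> level lists must fit into the size,
  \<open>n ^ d * N \<le> 2 ^ n\<close>, and the product errors must stay below the interpolation
  error, for which \<open>N ^ 2 \<ge> d * n ^ d * 2 ^ n\<close> suffices. Any exponent strictly
  between 1/2 and 1 would serve.\<close>

text \<open>The level \<open>k\<close> hat \<open>hat k s\<close> has its peak at \<open>(2 s + 1) / 2\<^bsup>k + 1\<^esup>\<close>; levels start at 0.\<close>

definition hat :: "nat \<Rightarrow> nat \<Rightarrow> real \<Rightarrow> real" where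
  "hat k s t = relu (1 - \<bar>2 ^ Suc k * t - (2 * real s + 1)\<bar>)"

definition sawtooth :: "nat \<Rightarrow> real \<Rightarrow> real" where
  "sawtooth k t = (\<Sum>s<2 ^ k. hat k s t)"

lemma relu_nonneg [simp]: "0 \<le> relu t"
  by (simp add: relu_def)

lemma relu_of_nonneg [simp]: "0 \<le> t \<Longrightarrow> relu t = t"
  by (simp add: relu_def)

lemma relu_of_nonpos [simp]: "t \<le> 0 \<Longrightarrow> relu t = 0"
  by (simp add: relu_def)

lemma hat_nonneg [simp]: "0 \<le> hat k s t"
  by (simp add: hat_def)

lemma hat_le_1: "hat k s t \<le> 1"
  by (simp add: hat_def relu_def)

text \<open>Activity of \<open>hat k s\<close> puts the scaled point \<open>2 ^ Suc k * t\<close> at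
  distance less than 1 from the odd number \<open>2 * s + 1\<close>, and distinct odd numbers are at
  least 2 apart.\<close>

lemma hat_pos_unique:
  assumes "hat k s t \<noteq> 0" "hat k r t \<noteq> 0"
  shows "s = r"
proof -
  have "\<bar>2 ^ Suc k * t - (2 * real s + 1)\<bar> < 1" if "hat k s t \<noteq> 0" for s
    by (rule ccontr) (use that in \<open>simp add: hat_def\<close>)
  from this[OF assms(1)] this[OF assms(2)]
  have "real s < real (r + 1)" "real r < real (s + 1)" by linarith+
  then show ?thesis unfolding of_nat_less_iff by linarith
qed

lemma hat_sum_active:
  assumes "hat k r t \<noteq> 0" "r < 2 ^ k"
  shows "(\<Sum>s<2 ^ k. c s * hat k s t) = c r * hat k r t"
proof -
  have "(\<Sum>s<2 ^ k. c s * hat k s t) = (\<Sum>s\<in>{r}. c s * hat k s t)"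
    using assms by (intro sum.mono_neutral_right) (auto dest: hat_pos_unique)
  then show ?thesis by simp
qed

lemma sawtooth_active:
  assumes "hat k r t \<noteq> 0" "r < 2 ^ k"
  shows "sawtooth k t = hat k r t"
  using hat_sum_active[OF assms, of "\<lambda>_. 1"] by (simp add: sawtooth_def)

lemma sawtooth_nonneg [simp]: "0 \<le> sawtooth k t"
  by (simp add: sawtooth_def sum_nonneg)

lemma sawtooth_le_1: "sawtooth k t \<le> 1"
proof (cases "\<exists>r<2 ^ k. hat k r t \<noteq> 0")
  case True
  then show ?thesis using sawtooth_active hat_le_1 by metis
next
  case False
  then show ?thesis by (simp add: sawtooth_def)
qed

lemma hat_le_sawtooth:
  assumes "s < 2 ^ k"
  shows "hat k s t \<le> sawtooth k t"
  unfolding sawtooth_def using assms by (intro member_le_sum) auto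

section \<open>The Faber series in one variable\<close>

text \<open>The hierarchical surplus: value at the peak of \<open>hat k s\<close> minus the linear
  interpolation from the ends of its support, that is, minus one half of a second difference of step
  \<open>1 / 2 ^ Suc k\<close>.\<close>

definition hier_coeff :: "nat \<Rightarrow> nat \<Rightarrow> (real \<Rightarrow> real) \<Rightarrow> real" where
  "hier_coeff k s G = G ((2 * real s + 1) / 2 ^ Suc k)
     - (G (2 * real s / 2 ^ Suc k) + G ((2 * real s + 2) / 2 ^ Suc k)) / 2"

text \<open>Each new level corrects the values at the midpoints and leaves the old nodes alone, so
  the partial sums interpolate linearly on the dyadic grid. Zero end values spare an affine part,
  and the closed cell condition on \<open>q\<close> also admits \<open>t = 1\<close>.\<close>

lemma faber_partial_sum:
  fixes G :: "real \<Rightarrow> real"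
  assumes "G 0 = 0" "G 1 = 0"
  assumes "q < 2 ^ n" "real q \<le> 2 ^ n * t" "2 ^ n * t \<le> real q + 1"
  shows "(\<Sum>k<n. \<Sum>s<2 ^ k. hier_coeff k s G * hat k s t) =
    (1 - (2 ^ n * t - real q)) * G (real q / 2 ^ n)
      + (2 ^ n * t - real q) * G ((real q + 1) / 2 ^ n)"
  using assms(3-5)
proof (induction n arbitrary: q)
  case 0
  then show ?case using assms by simp
next
  case (Suc n)
  \<comment> \<open>Cell \<open>q\<close> of level \<open>Suc n\<close> is the left
    (\<open>e = 0\<close>) or right (\<open>e = 1\<close>) half of the parent cell \<open>r\<close>;
    \<open>\<tau>\<close> below is the local coordinate in that half.\<close>
  define r where "r = q div 2"
  define e where "e = q mod 2"
  have q: "q = 2 * r + e" and e: "e = 0 \<or> e = 1"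
    by (auto simp: r_def e_def)
  define \<tau> where "\<tau> = 2 ^ Suc n * t - real q"
  have \<tau>: "0 \<le> \<tau>" "\<tau> \<le> 1" using Suc.prems by (auto simp: \<tau>_def)
  have t: "2 ^ n * t = real r + (real e + \<tau>) / 2" by (simp add: \<tau>_def q field_simps)
  have r: "r < 2 ^ n" using Suc.prems(1) by (simp add: r_def)
  have IH: "(\<Sum>k<n. \<Sum>s<2 ^ k. hier_coeff k s G * hat k s t) =
    (1 - (2 ^ n * t - real r)) * G (real r / 2 ^ n)
      + (2 ^ n * t - real r) * G ((real r + 1) / 2 ^ n)"
    by (rule Suc.IH[OF r]) (use t \<tau> e in \<open>auto\<close>)
  have hatr: "hat n r t = 1 - \<bar>real e + \<tau> - 1\<bar>"
  proof -
    have "2 ^ Suc n * t - (2 * real r + 1) = real e + \<tau> - 1" using t by (simp add: field_simps)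
    then show ?thesis using \<tau> e unfolding hat_def by (auto simp: relu_def)
  qed
  have "(\<Sum>s<2 ^ n. hier_coeff n s G * hat n s t) = hier_coeff n r G * hat n r t"
  proof (cases "hat n r t = 0")
    case False
    then show ?thesis using r by (rule hat_sum_active)
  next
    case True
    \<comment> \<open>Here \<open>t\<close> is an end of the parent cell, where all hats of level
      \<open>n\<close> vanish.\<close>
    have "hat n s t = 0" for s
    proof -
      have "2 ^ Suc n * t = 2 * real r + real e + \<tau>" using t by (simp add: field_simps)
      moreover have "real e + \<tau> = 0 \<or> real e + \<tau> = 2" using True hatr e \<tau> by auto
      ultimately have tt: "2 ^ Suc n * t = 2 * real r \<or> 2 ^ Suc n * t = 2 * real r + 2" by linarith
      have "s < r \<or> s = r \<or> s \<ge> r + 1" by linarith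
      then have "real s \<le> real r - 1 \<or> real s = real r \<or> real s \<ge> real r + 1" by linarith
      then have "1 \<le> \<bar>2 ^ Suc n * t - (2 * real s + 1)\<bar>" using tt by linarith
      then show ?thesis by (simp add: hat_def)
    qed
    then show ?thesis by simp
  qed
  then have "(\<Sum>k<Suc n. \<Sum>s<2 ^ k. hier_coeff k s G * hat k s t) =
     (1 - (real e + \<tau>) / 2) * G (real r / 2 ^ n) + ((real e + \<tau>) / 2) * G ((real r + 1) / 2 ^ n)
       + hier_coeff n r G * (1 - \<bar>real e + \<tau> - 1\<bar>)"
    using IH hatr t by simp
  also have "\<dots> = (1 - \<tau>) * G (real q / 2 ^ Suc n) + \<tau> * G ((real q + 1) / 2 ^ Suc n)"
  proof -
    have a: "2 * real r / 2 ^ Suc n = real r / 2 ^ n" "(2 * real r + 2) / 2 ^ Suc n = (real r + 1) / 2 ^ n"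
      by (simp_all add: field_simps)
    show ?thesis
      using e
    proof
      assume e: "e = 0"
      have "\<bar>real e + \<tau> - 1\<bar> = 1 - \<tau>" using e \<tau> by simp
      then show ?thesis using e unfolding hier_coeff_def a by (simp add: q field_simps)
    next
      assume e: "e = 1"
      have b: "\<bar>real e + \<tau> - 1\<bar> = \<tau>" using e \<tau> by simp
      have c: "real q / 2 ^ Suc n = (2 * real r + 1) / 2 ^ Suc n"
        "(real q + 1) / 2 ^ Suc n = (real r + 1) / 2 ^ n" using e by (simp_all add: q field_simps)
      show ?thesis using e unfolding hier_coeff_def a b c by (simp add: field_simps)
    qed
  qed
  finally show ?case by (simp add: \<tau>_def)
qed

section \<open>Piecewise linear squares and products\<close>

text \<open>Slope changes of the interpolant of the square: its slope right of the knot
  \<open>r / N\<close> is \<open>(2 * r + 1) / N\<close>, so it begins with \<open>1 / N\<close> and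
  then grows by \<open>2 / N\<close>. The knots will cover [0, 2], because a sum of two factors from
  [0, 1] gets squared.\<close>

definition sq_knot_weight :: "nat \<Rightarrow> nat \<Rightarrow> real" where
  "sq_knot_weight N r = (if r = 0 then 1 else 2) / real N"

definition sq_interp :: "nat \<Rightarrow> real \<Rightarrow> real" where
  "sq_interp N t = (\<Sum>r<2 * N. sq_knot_weight N r * relu (t - real r / real N))"

text \<open>A chord of a convex function lies above it; in a cell with local coordinate
  \<open>\<tau>\<close> the gap for the square is exactly
  \<open>\<tau> * (1 - \<tau>) / N ^ 2\<close>, largest at the middle.\<close>

lemma sq_interp_bounds:
  assumes N: "N > 0" and t: "0 \<le> t" "t \<le> 2"
  shows "t\<^sup>2 \<le> sq_interp N t" "sq_interp N t \<le> t\<^sup>2 + 1 / (4 * real N ^ 2)"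
proof -
  \<comment> \<open>At \<open>t = 2\<close> the floor would give \<open>2 * N\<close>, one past the
    last knot, so the last cell is chosen.\<close>
  define q where "q = (if t = 2 then 2 * N - 1 else nat \<lfloor>real N * t\<rfloor>)"
  define \<tau> where "\<tau> = real N * t - real q"
  have q: "q < 2 * N" and \<tau>: "0 \<le> \<tau>" "\<tau> \<le> 1"
  proof -
    show "q < 2 * N"
    proof (cases "t = 2")
      case False
      then have "real N * t < real N * 2" using N t by simp
      then show ?thesis using False t unfolding q_def by (simp add: floor_less_iff nat_less_iff)
    qed (use N in \<open>simp add: q_def\<close>)
    show "0 \<le> \<tau>" "\<tau> \<le> 1"
      using N t unfolding \<tau>_def q_def by (auto simp: of_nat_diff of_nat_nat split: if_splits) linarith
  qed
  have k: "relu (t - real r / real N) = (if r \<le> q then (real q + \<tau> - real r) / real N else 0)" for r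
  proof -
    have e: "t - real r / real N = (real q + \<tau> - real r) / real N" using N by (simp add: \<tau>_def field_simps)
    show ?thesis
    proof (cases "r \<le> q")
      case True
      then show ?thesis unfolding e using \<tau> by simp
    next
      case False
      then have "real q + \<tau> - real r \<le> 0" using \<tau> by linarith
      then show ?thesis unfolding e using False by (simp add: divide_nonpos_nonneg)
    qed
  qed
  have "sq_interp N t = (\<Sum>r\<in>{..q}. sq_knot_weight N r * ((real q + \<tau> - real r) / real N))"
    unfolding sq_interp_def k using q
    by (intro sum.mono_neutral_cong_right) (auto)
  also have "\<dots> = ((real q)\<^sup>2 + (2 * real q + 1) * \<tau>) / real N ^ 2"
  proof -
    have "(\<Sum>r\<in>{..m}. sq_knot_weight N r * ((c - real r) / real N)) =
       (c + 2 * real m * c - real m * (real m + 1)) / real N ^ 2" for m c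
      by (induction m) (use N in \<open>simp_all add: sq_knot_weight_def field_simps power2_eq_square\<close>)
    from this[of "real q + \<tau>" q] show ?thesis by (simp add: field_simps power2_eq_square)
  qed
  finally have S: "sq_interp N t = ((real q)\<^sup>2 + (2 * real q + 1) * \<tau>) / real N ^ 2" .
  have T: "t\<^sup>2 = (real q + \<tau>)\<^sup>2 / real N ^ 2"
    using N by (simp add: \<tau>_def field_simps power2_eq_square)
  have D: "sq_interp N t - t\<^sup>2 = (\<tau> - \<tau>\<^sup>2) / real N ^ 2"
    unfolding S T diff_divide_distrib[symmetric]
    by (rule arg_cong[where f = "\<lambda>y. y / real N ^ 2"]) (simp add: algebra_simps power2_eq_square)
  have "\<tau> * \<tau> \<le> \<tau>" using \<tau> mult_left_le by blast
  then have "0 \<le> \<tau> - \<tau>\<^sup>2" by (simp add: power2_eq_square)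
  then show "t\<^sup>2 \<le> sq_interp N t" using D by (simp add: field_simps)
  have "0 \<le> (\<tau> - 1/2)\<^sup>2" by simp
  then have "\<tau> - \<tau>\<^sup>2 \<le> 1/4" by (simp add: field_simps power2_eq_square)
  then have "(\<tau> - \<tau>\<^sup>2) / real N ^ 2 \<le> (1/4) / real N ^ 2" by (intro divide_right_mono) auto
  then show "sq_interp N t \<le> t\<^sup>2 + 1 / (4 * real N ^ 2)" using D by simp
qed

text \<open>Subtracting the error bound of \<^const>\<open>sq_interp\<close> makes this an approximation of
  \<open>a * b\<close> from below, which the localisation by \<open>support_gap\<close> relies on.\<close>

definition approx_mult :: "nat \<Rightarrow> real \<Rightarrow> real \<Rightarrow> real" where
  "approx_mult N a b =
     relu ((sq_interp N (a + b) - sq_interp N a - sq_interp N b) / 2 - 1 / (8 * real N ^ 2))"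

text \<open>Polarisation. With \<open>\<delta> = 1 / (8 * N ^ 2)\<close> each interpolated square is
  too large by at most \<open>2 * \<delta>\<close>, so the half difference lies between
  \<open>a * b - 2 * \<delta>\<close> and \<open>a * b + \<delta>\<close>. After the shift by
  \<open>\<delta>\<close> it is at most \<open>a * b\<close>, and rectifying is harmless since
  \<open>a * b\<close> is nonnegative.\<close>

lemma approx_mult_bounds:
  assumes N: "N > 0" and "0 \<le> a" "a \<le> 1" "0 \<le> b" "b \<le> 1"
  shows "0 \<le> approx_mult N a b" "approx_mult N a b \<le> a * b" "a * b - 1 / real N ^ 2 \<le> approx_mult N a b"
proof -
  note B = sq_interp_bounds[OF N]
  define \<delta> where "\<delta> = 1 / (8 * real N ^ 2)"
  have d: "1 / (4 * real N ^ 2) = 2 * \<delta>" "1 / real N ^ 2 = 8 * \<delta>" "0 \<le> \<delta>" by (simp_all add: \<delta>_def)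
  define E where "E = (sq_interp N (a + b) - sq_interp N a - sq_interp N b) / 2"
  have sq: "(a + b)\<^sup>2 = a\<^sup>2 + b\<^sup>2 + 2 * (a * b)" by (simp add: power2_eq_square algebra_simps)
  have "E \<le> a * b + \<delta>" "a * b - 2 * \<delta> \<le> E"
    using B[of "a + b"] B[of a] B[of b] assms unfolding E_def d sq by auto
  moreover have "approx_mult N a b = max (E - \<delta>) 0" by (simp add: approx_mult_def E_def \<delta>_def relu_def)
  moreover have "0 \<le> a * b" using assms by simp
  ultimately show "0 \<le> approx_mult N a b" "approx_mult N a b \<le> a * b" "a * b - 1 / real N ^ 2 \<le> approx_mult N a b"
    using d(3) unfolding d(2) by linarith+
qed

text \<open>In the lists below the head refers to the last coordinate: an entry followed by \<open>t\<close>
  belongs to coordinate \<open>length t\<close>.\<close>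

fun sparse_index :: "nat \<Rightarrow> nat \<Rightarrow> (nat \<times> nat) list set" where
  "sparse_index 0 n = {[]}"
| "sparse_index (Suc j) n =
     (\<Union>k<n. \<Union>s<2 ^ k. (#) (k, s) ` sparse_index j (n - Suc k))"

fun hat_prod :: "(nat \<times> nat) list \<Rightarrow> (nat \<Rightarrow> real) \<Rightarrow> real" where
  "hat_prod [] x = 1"
| "hat_prod ((k, s) # t) x = hat k s (x (length t)) * hat_prod t x"

fun approx_saw_prod :: "nat \<Rightarrow> nat list \<Rightarrow> (nat \<Rightarrow> real) \<Rightarrow> real" where
  "approx_saw_prod N [] x = 1"
| "approx_saw_prod N (k # t) x = approx_mult N (sawtooth k (x (length t))) (approx_saw_prod N t x)"

fun support_gap :: "(nat \<times> nat) list \<Rightarrow> (nat \<Rightarrow> real) \<Rightarrow> real" where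
  "support_gap [] x = 0"
| "support_gap ((k, s) # t) x =
     sawtooth k (x (length t)) - hat k s (x (length t)) + support_gap t x"

text \<open>On the support of \<open>hat_prod t\<close> the gap vanishes, and off it some hat is zero while its
  sawtooth still dominates the product, so the rectifier returns exactly 0. The product of sawtooths
  is shared by all hats of the same level, hence each hat product costs only one extra neuron.\<close>

definition approx_hat_prod :: "nat \<Rightarrow> (nat \<times> nat) list \<Rightarrow> (nat \<Rightarrow> real) \<Rightarrow> real" where
  "approx_hat_prod N t x = relu (approx_saw_prod N (map fst t) x - support_gap t x)"

section \<open>Counting and localising tensor hats\<close>

lemma finite_sparse_index [simp]: "finite (sparse_index j n)"
  by (induction j arbitrary: n) auto

lemma sparse_index_length: "t \<in> sparse_index j n \<Longrightarrow> length t = j"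
  by (induction j arbitrary: n t) auto

lemma sparse_index_mem:
  "t \<in> sparse_index j n \<Longrightarrow> (k, s) \<in> set t \<Longrightarrow> k < n \<and> s < 2 ^ k"
proof (induction j arbitrary: n t)
  case (Suc j)
  then obtain k' s' t' where "t = (k', s') # t'" "k' < n" "s' < 2 ^ k'" "t' \<in> sparse_index j (n - Suc k')"
    by auto
  then show ?case using Suc.IH[of t' "n - Suc k'"] Suc.prems(2) by auto
qed simp

lemma sum_sparse_index_Suc:
  fixes F :: "(nat \<times> nat) list \<Rightarrow> 'a :: comm_monoid_add"
  shows "(\<Sum>t\<in>sparse_index (Suc j) n. F t) =
    (\<Sum>k<n. \<Sum>s<2 ^ k. \<Sum>t\<in>sparse_index j (n - Suc k). F ((k, s) # t))"
proof -
  have R: "sum F ((#) a ` S) = (\<Sum>t\<in>S. F (a # t))" for a S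
    by (subst sum.reindex) (auto simp: inj_on_def)
  have "(\<Sum>t\<in>sparse_index (Suc j) n. F t) =
    (\<Sum>k<n. \<Sum>t\<in>(\<Union>s<2 ^ k. (#) (k, s) ` sparse_index j (n - Suc k)). F t)"
    unfolding sparse_index.simps by (rule sum.UNION_disjoint) auto
  also have "\<dots> = (\<Sum>k<n. \<Sum>s<2 ^ k. \<Sum>t\<in>(#) (k, s) ` sparse_index j (n - Suc k). F t)"
    by (intro sum.cong refl sum.UNION_disjoint) auto
  also have "\<dots> = (\<Sum>k<n. \<Sum>s<2 ^ k. \<Sum>t\<in>sparse_index j (n - Suc k). F ((k, s) # t))"
    by (simp add: R)
  finally show ?thesis .
qed

text \<open>For one coordinate the positions form a geometric sum, so no power of \<open>n\<close>
  arises. Every further coordinate offers at most \<open>n\<close> levels, and the positions of a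
  level together with those of the remaining budget number at most
  \<open>2 ^ n * (n + 1) ^ j\<close>. Hence the exponent is one less than the number of
  coordinates.\<close>

lemma card_sparse_index: "card (sparse_index (Suc j) n) \<le> 2 ^ n * (n + 1) ^ j"
proof (induction j arbitrary: n)
  case 0
  have "card (sparse_index (Suc 0) n) = (\<Sum>k<n. 2 ^ k)"
    by (simp only: card_eq_sum sum_sparse_index_Suc) simp
  also have "\<dots> = 2 ^ n - 1" by (induction n) auto
  finally show ?case by simp
next
  case (Suc j)
  have "card (sparse_index (Suc (Suc j)) n) = (\<Sum>k<n. 2 ^ k * card (sparse_index (Suc j) (n - Suc k)))"
    unfolding card_eq_sum by (subst sum_sparse_index_Suc) simp
  also have "\<dots> \<le> (\<Sum>k<n. 2 ^ n * (n + 1) ^ j)"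
  proof (rule sum_mono)
    fix k assume k: "k \<in> {..<n}"
    have "2 ^ k * card (sparse_index (Suc j) (n - Suc k)) \<le> 2 ^ k * (2 ^ (n - Suc k) * (n - Suc k + 1) ^ j)"
      by (intro mult_left_mono Suc) auto
    also have "\<dots> \<le> 2 ^ k * (2 ^ (n - k) * (n + 1) ^ j)"
      by (intro mult_left_mono mult_mono power_mono power_increasing) auto
    also have "\<dots> = 2 ^ n * (n + 1) ^ j" using k by (simp flip: power_add)
    finally show "2 ^ k * card (sparse_index (Suc j) (n - Suc k)) \<le> 2 ^ n * (n + 1) ^ j" .
  qed
  also have "\<dots> \<le> 2 ^ n * (n + 1) ^ Suc j" by simp
  finally show ?case .
qed

lemma approx_saw_prod_bounds:
  assumes "N > 0"
  shows "0 \<le> approx_saw_prod N t x \<and> approx_saw_prod N t x \<le> 1"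
proof (induction t)
  case (Cons k t)
  have "approx_saw_prod N (k # t) x \<le> sawtooth k (x (length t)) * approx_saw_prod N t x"
    using Cons approx_mult_bounds[OF assms] sawtooth_le_1 by simp
  also have "\<dots> \<le> 1" using Cons sawtooth_le_1 by (intro mult_le_one) auto
  finally show ?case using Cons approx_mult_bounds[OF assms] sawtooth_le_1 by simp
qed simp

lemma support_gap_nonneg:
  assumes "\<And>k s. (k, s) \<in> set t \<Longrightarrow> s < 2 ^ k"
  shows "0 \<le> support_gap t x"
  using assms
proof (induction t)
  case (Cons a t)
  obtain k s where a: "a = (k, s)" by (cases a)
  have "hat k s (x (length t)) \<le> sawtooth k (x (length t))" using Cons.prems a by (intro hat_le_sawtooth) auto
  moreover have "0 \<le> support_gap t x" using Cons by auto
  ultimately show ?case using a by simp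
qed simp

text \<open>If the leading hat vanishes, the gap contains its whole sawtooth, which dominates the
  product because the other factor is at most 1. Otherwise the sawtooth equals the hat, a later
  factor vanishes, and the inequality is inherited from the tail. Both cases rely on
  \<open>approx_mult\<close> never exceeding the true product.\<close>

lemma approx_hat_prod_inactive:
  assumes "N > 0" "\<And>k s. (k, s) \<in> set t \<Longrightarrow> s < 2 ^ k" "hat_prod t x = 0"
  shows "approx_hat_prod N t x = 0"
proof -
  have "approx_saw_prod N (map fst t) x \<le> support_gap t x"
    using assms(2,3)
  proof (induction t)
    case (Cons a t)
    obtain k s where a: "a = (k, s)" by (cases a)
    let ?y = "x (length t)"
    have s: "s < 2 ^ k" using Cons.prems a by auto
    have gap: "0 \<le> support_gap t x" using Cons.prems by (intro support_gap_nonneg) auto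
    have b: "0 \<le> approx_saw_prod N (map fst t) x" "approx_saw_prod N (map fst t) x \<le> 1"
      using approx_saw_prod_bounds[OF assms(1)] by auto
    have up: "approx_saw_prod N (map fst (a # t)) x \<le> sawtooth k ?y * approx_saw_prod N (map fst t) x"
      using a b approx_mult_bounds[OF assms(1)] sawtooth_le_1 by simp
    show ?case
    proof (cases "hat k s ?y = 0")
      case True
      have "sawtooth k ?y * approx_saw_prod N (map fst t) x \<le> sawtooth k ?y"
        using b by (simp add: mult_left_le)
      then show ?thesis using up a True gap by simp
    next
      case False
      then have "hat_prod t x = 0" using Cons.prems a by simp
      then have "approx_saw_prod N (map fst t) x \<le> support_gap t x" using Cons by auto
      moreover have "sawtooth k ?y * approx_saw_prod N (map fst t) x \<le> approx_saw_prod N (map fst t) x"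
        using b sawtooth_le_1 by (simp add: mult_left_le_one_le)
      moreover have "sawtooth k ?y = hat k s ?y" using False s by (rule sawtooth_active)
      ultimately show ?thesis using up a by simp
    qed
  qed simp
  then show ?thesis by (simp add: approx_hat_prod_def)
qed

text \<open>On the support every sawtooth coincides with its hat, so nothing is subtracted. All
  factors are at most 1, hence the errors of successive multiplications only add.\<close>

lemma approx_hat_prod_active:
  assumes "N > 0" "\<And>k s. (k, s) \<in> set t \<Longrightarrow> s < 2 ^ k" "hat_prod t x \<noteq> 0"
  shows "\<bar>approx_hat_prod N t x - hat_prod t x\<bar> \<le> real (length t) / real N ^ 2"
proof -
  have "support_gap t x = 0 \<and> \<bar>approx_saw_prod N (map fst t) x - hat_prod t x\<bar> \<le> real (length t) / real N ^ 2"
    using assms(2,3)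
  proof (induction t)
    case (Cons a t)
    obtain k s where a: "a = (k, s)" by (cases a)
    let ?y = "x (length t)"
    let ?A = "approx_saw_prod N (map fst t) x"
    have s: "s < 2 ^ k" using Cons.prems a by auto
    have nz: "hat k s ?y \<noteq> 0" "hat_prod t x \<noteq> 0" using Cons.prems a by auto
    have saw: "sawtooth k ?y = hat k s ?y" using nz s by (intro sawtooth_active)
    have IH: "support_gap t x = 0" "\<bar>?A - hat_prod t x\<bar> \<le> real (length t) / real N ^ 2"
      using Cons nz by auto
    have b: "0 \<le> ?A" "?A \<le> 1"
      using approx_saw_prod_bounds[OF assms(1)] by auto
    have "\<bar>approx_mult N (hat k s ?y) ?A - hat k s ?y * ?A\<bar> \<le> 1 / real N ^ 2"
      using approx_mult_bounds[OF assms(1), of "hat k s ?y" ?A] b hat_le_1 by auto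
    moreover have "\<bar>hat k s ?y * ?A - hat k s ?y * hat_prod t x\<bar> \<le> real (length t) / real N ^ 2"
    proof -
      have "\<bar>hat k s ?y * ?A - hat k s ?y * hat_prod t x\<bar> = hat k s ?y * \<bar>?A - hat_prod t x\<bar>"
        by (simp flip: right_diff_distrib add: abs_mult)
      also have "\<dots> \<le> 1 * \<bar>?A - hat_prod t x\<bar>" by (intro mult_right_mono hat_le_1) auto
      finally show ?thesis using IH by simp
    qed
    ultimately show ?case using a saw IH by (simp add: add_divide_distrib)
  qed simp
  then show ?thesis using approx_saw_prod_bounds[OF assms(1)] by (simp add: approx_hat_prod_def)
qed

text \<open>At a fixed point the levels of an active tensor hat determine its positions, since in
  each coordinate at most one hat per level is active. So active hats are no more numerous than
  level lists.\<close>

lemma card_active_le: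
  "card {t \<in> sparse_index d n. hat_prod t x \<noteq> 0} \<le> n ^ d"
proof -
  let ?S = "{t \<in> sparse_index d n. hat_prod t x \<noteq> 0}"
  have inj: "u = v" if "map fst u = map fst v" "hat_prod u x \<noteq> 0" "hat_prod v x \<noteq> 0" for u v :: "(nat \<times> nat) list"
    using that
  proof (induction u arbitrary: v)
    case (Cons a u)
    obtain k s where a: "a = (k, s)" by (cases a)
    from Cons.prems obtain r v' where v: "v = (k, r) # v'" "map fst u = map fst v'" using a by auto
    have "length u = length v'" using v(2) by (metis length_map)
    then show ?case using Cons v a hat_pos_unique[of k s "x (length u)" r] by auto
  qed simp
  have "card ?S = card (map fst ` ?S)"
    by (rule card_image[symmetric]) (auto simp: inj_on_def intro: inj)
  also have "\<dots> \<le> card {l. set l \<subseteq> {..<n} \<and> length l = d}"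
  proof (rule card_mono)
    show "map fst ` ?S \<subseteq> {l. set l \<subseteq> {..<n} \<and> length l = d}"
      using sparse_index_length sparse_index_mem by fastforce
  qed (simp add: finite_lists_length_eq)
  also have "\<dots> = n ^ d" by (simp add: card_lists_length_eq)
  finally show ?thesis .
qed

lemma approx_hat_prod_sum_error:
  assumes "N > 0" and coeff: "\<And>t. t \<in> sparse_index d n \<Longrightarrow> \<bar>c t\<bar> \<le> (1::real)"
  shows "\<bar>(\<Sum>t\<in>sparse_index d n. c t * approx_hat_prod N t x) - (\<Sum>t\<in>sparse_index d n. c t * hat_prod t x)\<bar>
    \<le> real d * real n ^ d / real N ^ 2"
proof -
  let ?S = "{t \<in> sparse_index d n. hat_prod t x \<noteq> 0}"
  have "(\<Sum>t\<in>sparse_index d n. c t * approx_hat_prod N t x) - (\<Sum>t\<in>sparse_index d n. c t * hat_prod t x)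
    = (\<Sum>t\<in>sparse_index d n. c t * (approx_hat_prod N t x - hat_prod t x))"
    by (simp add: sum_subtractf right_diff_distrib)
  also have "\<dots> = (\<Sum>t\<in>?S. c t * (approx_hat_prod N t x - hat_prod t x))"
  proof (rule sum.mono_neutral_right)
    show "\<forall>t\<in>sparse_index d n - ?S. c t * (approx_hat_prod N t x - hat_prod t x) = 0"
      using approx_hat_prod_inactive[OF assms(1)] sparse_index_mem by fastforce
  qed auto
  also have "\<bar>\<dots>\<bar> \<le> (\<Sum>t\<in>?S. real d / real N ^ 2)"
  proof (rule order_trans[OF sum_abs sum_mono])
    fix t assume t: "t \<in> ?S"
    then have "\<bar>approx_hat_prod N t x - hat_prod t x\<bar> \<le> real (length t) / real N ^ 2"
      using sparse_index_mem by (intro approx_hat_prod_active[OF assms(1)]) auto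
    moreover have "length t = d" using t sparse_index_length by auto
    ultimately have "\<bar>c t\<bar> * \<bar>approx_hat_prod N t x - hat_prod t x\<bar> \<le> 1 * (real d / real N ^ 2)"
      using coeff t by (intro mult_mono) auto
    then show "\<bar>c t * (approx_hat_prod N t x - hat_prod t x)\<bar> \<le> real d / real N ^ 2" by (simp add: abs_mult)
  qed
  also have "\<dots> = real (card ?S) * (real d / real N ^ 2)" by simp
  also have "\<dots> \<le> real (n ^ d) * (real d / real N ^ 2)"
    by (intro mult_right_mono of_nat_mono card_active_le) simp
  finally show ?thesis by (simp add: mult.commute)
qed

subsection \<open>Sparse grid approximation of mixed Hoelder functions\<close>

lemma fold_diff1_linear:
  "fold (\<lambda>i. diff1 i (h i)) xs (\<lambda>x. a * g1 x + b * g2 x) =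
   (\<lambda>x. a * fold (\<lambda>i. diff1 i (h i)) xs g1 x + b * fold (\<lambda>i. diff1 i (h i)) xs g2 x)"
proof (induction xs arbitrary: g1 g2)
  case (Cons i xs)
  have "diff1 i (h i) (\<lambda>x. a * g1 x + b * g2 x) =
      (\<lambda>x. a * diff1 i (h i) g1 x + b * diff1 i (h i) g2 x)"
    by (simp add: diff1_def algebra_simps)
  then show ?case by (simp add: Cons)
qed simp

text \<open>This allows a hierarchical coefficient in variable \<open>j\<close> to be pulled through
  a mixed difference in the other variables.\<close>

lemma fold_diff1_upd:
  assumes "j \<notin> set xs"
  shows "fold (\<lambda>i. diff1 i (h i)) xs (\<lambda>x. g (x(j := c))) =
    (\<lambda>x. fold (\<lambda>i. diff1 i (h i)) xs g (x(j := c)))"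
  using assms
proof (induction xs arbitrary: g)
  case (Cons i xs)
  let ?F = "fold (\<lambda>i. diff1 i (h i))"
  have eq: "diff1 i (h i) (\<lambda>x. g (x(j := c))) = (\<lambda>x. diff1 i (h i) g (x(j := c)))"
    using Cons.prems by (auto simp: diff1_def fun_upd_twist)
  have "?F (i # xs) (\<lambda>x. g (x(j := c))) = ?F xs (\<lambda>x. diff1 i (h i) g (x(j := c)))"
    by (simp only: fold_Cons o_apply eq)
  also have "\<dots> = (\<lambda>x. ?F xs (diff1 i (h i) g) (x(j := c)))"
    using Cons.prems by (intro Cons.IH) simp
  finally show ?case by (simp only: fold_Cons o_apply)
qed simp

text \<open>The largest index comes last in \<open>sorted_list_of_set\<close>, so its difference is
  applied last. For this reason the induction below splits off the highest coordinate.\<close>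

lemma mixed_diff_insert_max:
  assumes "u \<subseteq> {..<j}"
  shows "mixed_diff h (insert j u) g = diff1 j (h j) (mixed_diff h u g)"
proof -
  have fin: "finite u" using assms finite_subset by blast
  have "sorted_list_of_set (insert j u) = insort j (sorted_list_of_set u)"
    using assms fin by (subst sorted_list_of_set.sorted_key_list_of_set_insert) auto
  also have "\<dots> = sorted_list_of_set u @ [j]"
    using assms fin by (intro sorted_insort_is_snoc) auto
  finally show ?thesis by (simp add: mixed_diff_def)
qed

lemma mixed_diff_cong:
  assumes "\<And>i. i \<in> u \<Longrightarrow> h i = h' i"
  shows "mixed_diff h u g = mixed_diff h' u g"
proof (cases "finite u")
  case True
  then show ?thesis unfolding mixed_diff_def using assms by (intro fold_cong) auto
qed (simp add: mixed_diff_def)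

text \<open>The Hoelder condition as a real inequality with denominators cleared. Only differences
  in the first \<open>j\<close> variables are controlled: in the induction the later variables have
  already been expanded, and \<open>M\<close> collects the decay gained from them.\<close>

definition mixed_bounded ::
    "real \<Rightarrow> nat \<Rightarrow> nat \<Rightarrow> real \<Rightarrow> ((nat \<Rightarrow> real) \<Rightarrow> real) \<Rightarrow> bool" where
  "mixed_bounded \<alpha> d j M g \<longleftrightarrow>
     (\<forall>u h. u \<subseteq> {..<j} \<longrightarrow> (\<forall>i<d. 0 < h i) \<longrightarrow>
       (\<forall>x\<in>shift_cube d h u. \<bar>mixed_diff h u g x\<bar> \<le> M * (\<Prod>i\<in>u. h i powr \<alpha>)))"

lemma mixed_boundedD:
  assumes "mixed_bounded \<alpha> d j M g" "u \<subseteq> {..<j}" "\<And>i. i < d \<Longrightarrow> 0 < h i" "x \<in> shift_cube d h u"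
  shows "\<bar>mixed_diff h u g x\<bar> \<le> M * (\<Prod>i\<in>u. h i powr \<alpha>)"
  using assms unfolding mixed_bounded_def by simp

definition hier_slice ::
    "nat \<Rightarrow> nat \<Rightarrow> nat \<Rightarrow> ((nat \<Rightarrow> real) \<Rightarrow> real) \<Rightarrow> (nat \<Rightarrow> real) \<Rightarrow> real" where
  "hier_slice j k s g x = hier_coeff k s (\<lambda>t. g (x(j := t)))"

lemma unit_cube_upd:
  assumes "x \<in> unit_cube d" "j < d" "0 \<le> c" "c \<le> 1"
  shows "x(j := c) \<in> unit_cube d"
  using assms unfolding unit_cube_def by (auto simp: PiE_iff extensional_def)

lemma dyadic_nodes:
  assumes "s < 2 ^ k"
  shows "0 \<le> 2 * real s / 2 ^ Suc k" "(2 * real s + 2) / 2 ^ Suc k \<le> 1"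
    "2 * real s / 2 ^ Suc k + 1 / 2 ^ Suc k = (2 * real s + 1) / 2 ^ Suc k"
    "(2 * real s + 1) / 2 ^ Suc k + 1 / 2 ^ Suc k = (2 * real s + 2) / 2 ^ Suc k"
    "0 \<le> (2 * real s + 1) / 2 ^ Suc k" "(2 * real s + 1) / 2 ^ Suc k \<le> 1"
    "2 * real s / 2 ^ Suc k \<le> 1" "0 \<le> (2 * real s + 2) / 2 ^ Suc k"
proof -
  have "s + 1 \<le> 2 ^ k" using assms by simp
  then have "real (s + 1) \<le> real (2 ^ k)" by (rule of_nat_mono)
  then have "real s + 1 \<le> 2 ^ k" by simp
  with assms show "0 \<le> 2 * real s / 2 ^ Suc k" "(2 * real s + 2) / 2 ^ Suc k \<le> 1"
    "2 * real s / 2 ^ Suc k + 1 / 2 ^ Suc k = (2 * real s + 1) / 2 ^ Suc k"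
    "(2 * real s + 1) / 2 ^ Suc k + 1 / 2 ^ Suc k = (2 * real s + 2) / 2 ^ Suc k"
    "0 \<le> (2 * real s + 1) / 2 ^ Suc k" "(2 * real s + 1) / 2 ^ Suc k \<le> 1"
    "2 * real s / 2 ^ Suc k \<le> 1" "0 \<le> (2 * real s + 2) / 2 ^ Suc k"
    by (auto simp: field_simps)
qed

lemma half_power_eq_powr: "1 / 2 ^ m = (2::real) powr - real m"
  by (simp add: powr_minus powr_realpow divide_inverse)

lemma abs_half_diff_le:
  fixes a b K :: real
  assumes "\<bar>a\<bar> \<le> K" "\<bar>b\<bar> \<le> K"
  shows "\<bar>(a - b) / 2\<bar> \<le> K"
  using assms by (simp add: abs_le_iff field_simps)

text \<open>The surplus is half the difference of two adjacent first differences of step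
  \<open>\<eta> = 1 / 2 ^ Suc k\<close>. Adding \<open>j\<close> to the directions bounds each of
  them with an extra factor \<open>\<eta> powr \<alpha>\<close>, and the half compensates for there
  being two, so no constant is lost.\<close>

lemma mixed_bounded_slice:
  assumes g: "mixed_bounded \<alpha> d (Suc j) M g" and j: "j < d" and s: "s < 2 ^ k"
  shows "mixed_bounded \<alpha> d j (M * 2 powr (- \<alpha> * real (Suc k))) (hier_slice j k s g)"
  unfolding mixed_bounded_def
proof (intro allI impI ballI)
  fix u and h :: "nat \<Rightarrow> real" and x
  assume u: "u \<subseteq> {..<j}" and h: "\<forall>i<d. 0 < h i" and x: "x \<in> shift_cube d h u"
  define \<eta> :: real where "\<eta> = 1 / 2 ^ Suc k"
  \<comment> \<open>The steps in the directions of \<open>u\<close> stay arbitrary; the one in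
    direction \<open>j\<close> is tied to the level.\<close>
  define h' where "h' = h(j := \<eta>)"
  define D where "D = mixed_diff h u g"
  let ?l = "2 * real s / 2 ^ Suc k" and ?m = "(2 * real s + 1) / 2 ^ Suc k"
    and ?r = "(2 * real s + 2) / 2 ^ Suc k"
  note nodes = dyadic_nodes[OF s, folded \<eta>_def]
  have ju: "j \<notin> u" and fu: "finite u" using u finite_subset by auto
  have jl: "j \<notin> set (sorted_list_of_set u)" using ju fu by simp
  have D': "mixed_diff h' u g = D" unfolding D_def h'_def using ju by (intro mixed_diff_cong) auto
  have "mixed_diff h u (hier_slice j k s g) x = D (x(j := ?m)) - (D (x(j := ?l)) + D (x(j := ?r))) / 2"
  proof -
    have "hier_slice j k s g =
      (\<lambda>x. 1 * g (x(j := ?m)) + (-1/2) * (1 * g (x(j := ?l)) + 1 * g (x(j := ?r))))"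
      by (auto simp: hier_slice_def hier_coeff_def)
    then show ?thesis unfolding mixed_diff_def D_def
      by (simp only: fold_diff1_linear fold_diff1_upd[OF jl]) (simp add: field_simps)
  qed
  also have "\<dots> = (diff1 j \<eta> D (x(j := ?l)) - diff1 j \<eta> D (x(j := ?m))) / 2"
  proof -
    have d: "diff1 j \<eta> D (x(j := c)) = D (x(j := c + \<eta>)) - D (x(j := c))" for c
      by (simp add: diff1_def)
    have e: "a - (b + c) / 2 = ((a - b) - (c - a)) / 2" for a b c :: real
      by (simp add: field_simps)
    show ?thesis unfolding d nodes(3,4) by (rule e)
  qed
  finally have eq: "mixed_diff h u (hier_slice j k s g) x =
      (diff1 j \<eta> D (x(j := ?l)) - diff1 j \<eta> D (x(j := ?m))) / 2" .
  have h': "\<forall>i<d. 0 < h' i" using h by (auto simp: h'_def \<eta>_def)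
  have bound: "\<bar>diff1 j \<eta> D (x(j := c))\<bar> \<le> M * ((\<Prod>i\<in>u. h i powr \<alpha>) * \<eta> powr \<alpha>)"
    if c: "0 \<le> c" "c \<le> 1" "0 \<le> c + \<eta>" "c + \<eta> \<le> 1" for c
  proof -
    have "x(j := c) \<in> shift_cube d h' (insert j u)"
      using x c j ju by (auto simp: shift_cube_def h'_def unit_cube_upd)
    moreover have "insert j u \<subseteq> {..<Suc j}" using u by auto
    ultimately have "\<bar>mixed_diff h' (insert j u) g (x(j := c))\<bar> \<le> M * (\<Prod>i\<in>insert j u. h' i powr \<alpha>)"
      using h' by (intro mixed_boundedD[OF g]) auto
    moreover have "mixed_diff h' (insert j u) g = diff1 j \<eta> D"
      using mixed_diff_insert_max[OF u] D' by (simp add: h'_def)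
    moreover have "(\<Prod>i\<in>u. h' i powr \<alpha>) = (\<Prod>i\<in>u. h i powr \<alpha>)"
      using ju by (intro prod.cong) (auto simp: h'_def)
    then have "(\<Prod>i\<in>insert j u. h' i powr \<alpha>) = (\<Prod>i\<in>u. h i powr \<alpha>) * \<eta> powr \<alpha>"
      using fu ju by (simp add: h'_def mult.commute)
    ultimately show ?thesis by simp
  qed
  have "\<bar>mixed_diff h u (hier_slice j k s g) x\<bar> \<le> M * ((\<Prod>i\<in>u. h i powr \<alpha>) * \<eta> powr \<alpha>)"
  proof -
    have "\<bar>diff1 j \<eta> D (x(j := ?l))\<bar> \<le> M * ((\<Prod>i\<in>u. h i powr \<alpha>) * \<eta> powr \<alpha>)"
      by (rule bound) (simp_all only: nodes)
    moreover have "\<bar>diff1 j \<eta> D (x(j := ?m))\<bar> \<le> M * ((\<Prod>i\<in>u. h i powr \<alpha>) * \<eta> powr \<alpha>)"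
      by (rule bound) (simp_all only: nodes)
    ultimately show ?thesis unfolding eq by (rule abs_half_diff_le)
  qed
  moreover have "\<eta> powr \<alpha> = 2 powr (- \<alpha> * real (Suc k))"
  proof -
    have "\<eta> = 2 powr (- real (Suc k))"
      unfolding \<eta>_def by (rule half_power_eq_powr)
    then show ?thesis by (simp only: powr_powr) (simp only: mult.commute mult_minus_left mult_minus_right)
  qed
  ultimately show "\<bar>mixed_diff h u (hier_slice j k s g) x\<bar>
      \<le> M * 2 powr (- \<alpha> * real (Suc k)) * (\<Prod>i\<in>u. h i powr \<alpha>)" by (simp add: mult_ac)
qed

lemma mixed_bounded_holder:
  assumes g: "mixed_bounded \<alpha> d (Suc j) M g" and j: "j < d" and x: "x \<in> unit_cube d"
    and M: "0 \<le> M" and a: "0 \<le> a" "a \<le> 1" and b: "0 \<le> b" "b \<le> 1"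
  shows "\<bar>g (x(j := a)) - g (x(j := b))\<bar> \<le> M * \<bar>a - b\<bar> powr \<alpha>"
proof -
  have *: "\<bar>g (x(j := b)) - g (x(j := a))\<bar> \<le> M * (b - a) powr \<alpha>"
    if ab: "a < b" "0 \<le> a" "b \<le> 1" for a b
  proof -
    have "x(j := a) \<in> shift_cube d (\<lambda>_. b - a) {j}"
      using x j ab by (auto simp: shift_cube_def unit_cube_upd)
    then have "\<bar>mixed_diff (\<lambda>_. b - a) {j} g (x(j := a))\<bar> \<le> M * (\<Prod>i\<in>{j}. (b - a) powr \<alpha>)"
      using ab by (intro mixed_boundedD[OF g]) auto
    then show ?thesis by (simp add: mixed_diff_def diff1_def)
  qed
  show ?thesis
  proof (cases a b rule: linorder_cases)
    case less
    from *[OF this] show ?thesis using a b less by (simp add: abs_minus_commute)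
  next
    case greater
    from *[OF this] show ?thesis using a b greater by simp
  qed simp
qed

text \<open>The partial sum is a convex combination of the values at the two grid points around
  \<open>x j\<close>. Both are within \<open>1 / 2 ^ n\<close>, so the one-variable Hoelder bound
  applies to each.\<close>

lemma hier_interpolation_error:
  assumes g: "mixed_bounded \<alpha> d (Suc j) M g" and j: "j < d" and x: "x \<in> unit_cube d"
    and M: "0 \<le> M" and \<alpha>: "0 < \<alpha>"
    and z: "\<And>y i. y \<in> unit_cube d \<Longrightarrow> i < Suc j \<Longrightarrow> y i = 0 \<or> y i = 1 \<Longrightarrow> g y = 0"
  shows "\<bar>g x - (\<Sum>k<n. \<Sum>s<2 ^ k. hier_slice j k s g x * hat k s (x j))\<bar> \<le> M * 2 powr (- \<alpha> * real n)"
proof -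
  define t where "t = x j"
  have t: "0 \<le> t" "t \<le> 1" using x j by (auto simp: unit_cube_def t_def PiE_iff)
  define q where "q = (if t = 1 then 2 ^ n - 1 else nat \<lfloor>2 ^ n * t\<rfloor>)"
  define \<tau> where "\<tau> = 2 ^ n * t - real q"
  have q: "q < 2 ^ n" and \<tau>: "0 \<le> \<tau>" "\<tau> \<le> 1"
  proof -
    show "q < 2 ^ n"
    proof (cases "t = 1")
      case False
      then have "2 ^ n * t < 2 ^ n * 1" using t by (intro mult_strict_left_mono) auto
      then show ?thesis using False t unfolding q_def by (simp add: floor_less_iff nat_less_iff)
    qed (simp add: q_def)
    show "0 \<le> \<tau>" "\<tau> \<le> 1"
      using t unfolding \<tau>_def q_def by (auto simp: of_nat_diff split: if_splits) linarith
  qed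
  define G where "G = (\<lambda>y. g (x(j := y)))"
  have G: "G 0 = 0" "G 1 = 0" unfolding G_def using x j by (auto intro!: z[of _ j] unit_cube_upd)
  have gx: "g x = G t" by (simp add: G_def t_def)
  have "\<bar>G t - G y\<bar> \<le> M * 2 powr (- \<alpha> * real n)" if y: "0 \<le> y" "y \<le> 1" "\<bar>t - y\<bar> \<le> 1 / 2 ^ n" for y
  proof -
    have "\<bar>G t - G y\<bar> \<le> M * \<bar>t - y\<bar> powr \<alpha>"
      unfolding G_def using mixed_bounded_holder[OF g j x M] t y by auto
    also have "\<dots> \<le> M * (1 / 2 ^ n) powr \<alpha>"
      using M y \<alpha> by (intro mult_left_mono powr_mono2) auto
    also note half_power_eq_powr
    finally show ?thesis by (simp only: powr_powr) (simp only: mult.commute mult_minus_left mult_minus_right)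
  qed note near = this
  have qn: "real q + 1 \<le> 2 ^ n" using q by (metis Suc_leI add.commute of_nat_Suc of_nat_le_iff of_nat_numeral of_nat_power)
  have tq: "t = (real q + \<tau>) / 2 ^ n" by (simp add: \<tau>_def)
  have n1: "\<bar>G t - G (real q / 2 ^ n)\<bar> \<le> M * 2 powr (- \<alpha> * real n)"
    using q qn \<tau> by (intro near) (auto simp: tq field_simps)
  have n2: "\<bar>G t - G ((real q + 1) / 2 ^ n)\<bar> \<le> M * 2 powr (- \<alpha> * real n)"
    using q qn \<tau> by (intro near) (auto simp: tq field_simps)
  have "(\<Sum>k<n. \<Sum>s<2 ^ k. hier_slice j k s g x * hat k s (x j)) =
    (1 - \<tau>) * G (real q / 2 ^ n) + \<tau> * G ((real q + 1) / 2 ^ n)"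
    using faber_partial_sum[OF G q, of t] \<tau> unfolding hier_slice_def G_def[symmetric] t_def[symmetric] \<tau>_def
    by simp
  then have "g x - (\<Sum>k<n. \<Sum>s<2 ^ k. hier_slice j k s g x * hat k s (x j)) =
    (1 - \<tau>) * (G t - G (real q / 2 ^ n)) + \<tau> * (G t - G ((real q + 1) / 2 ^ n))"
    by (simp add: gx algebra_simps)
  also have "\<bar>\<dots>\<bar> \<le> (1 - \<tau>) * \<bar>G t - G (real q / 2 ^ n)\<bar> + \<tau> * \<bar>G t - G ((real q + 1) / 2 ^ n)\<bar>"
    using \<tau> by (intro order_trans[OF abs_triangle_ineq]) (simp add: abs_mult)
  also have "\<dots> \<le> (1 - \<tau>) * (M * 2 powr (- \<alpha> * real n)) + \<tau> * (M * 2 powr (- \<alpha> * real n))"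
    using \<tau> n1 n2 by (intro add_mono mult_left_mono) auto
  finally show ?thesis by (simp add: algebra_simps)
qed

section \<open>The sparse grid estimate\<close>

text \<open>The highest variable is expanded up to level \<open>n\<close>, and each coefficient, a
  function of the lower variables, is approximated with the remaining budget
  \<open>n - Suc k\<close>. Decay of the coefficient times recursive error has the same exponent
  \<open>- \<alpha> * n\<close> for all \<open>k\<close>, so the levels merely add up to one more
  factor \<open>n + 1\<close>. The positions do not multiply the error, because the hats of a level
  sum to a sawtooth of height at most 1.\<close>

lemma sparse_grid_approx:
  assumes \<alpha>: "0 < \<alpha>"
  assumes "j \<le> d" "0 \<le> M" "mixed_bounded \<alpha> d j M g"
    "\<And>y i. y \<in> unit_cube d \<Longrightarrow> i < j \<Longrightarrow> y i = 0 \<or> y i = 1 \<Longrightarrow> g y = 0"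
    "\<And>y z. y \<in> unit_cube d \<Longrightarrow> z \<in> unit_cube d \<Longrightarrow> (\<And>i. i < j \<Longrightarrow> y i = z i) \<Longrightarrow> g y = g z"
  shows "\<exists>c. (\<forall>t\<in>sparse_index j n. \<bar>c t\<bar> \<le> M) \<and>
    (\<forall>x\<in>unit_cube d. \<bar>g x - (\<Sum>t\<in>sparse_index j n. c t * hat_prod t x)\<bar>
       \<le> M * 2 powr (- \<alpha> * real n) * (if j = 0 then 0 else real (n + 1) ^ (j - 1)))"
  using assms(2-)
proof (induction j arbitrary: M g n)
  case 0
  \<comment> \<open>For \<open>j = 0\<close> the function is constant on the cube, so its value at
    one corner is an exact coefficient; this accounts for the error 0 in that case.\<close>
  define x0 :: "nat \<Rightarrow> real" where "x0 = (\<lambda>i. if i < d then 0 else undefined)"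
  have x0: "x0 \<in> unit_cube d" by (auto simp: x0_def unit_cube_def PiE_iff extensional_def)
  have "\<bar>g x0\<bar> \<le> M"
  proof -
    have "x0 \<in> shift_cube d (\<lambda>_. 1) {}" using x0 by (simp add: shift_cube_def)
    then show ?thesis using mixed_boundedD[OF 0(3), of "{}" "\<lambda>_. 1" x0] by (simp add: mixed_diff_def)
  qed
  moreover have "\<bar>g x - g x0\<bar> \<le> 0" if "x \<in> unit_cube d" for x using 0(5)[OF that x0] by simp
  ultimately show ?case by (intro exI[of _ "\<lambda>_. g x0"]) simp
next
  case (Suc j)
  have j: "j < d" using Suc.prems(1) by simp
  \<comment> \<open>Factor of the recursive error. Its value 0 at \<open>j = 0\<close> makes
    \<open>1 + n * E\<close> equal to 1, so the first variable brings in no power of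
    \<open>n + 1\<close>.\<close>
  define E :: real where "E = (if j = 0 then 0 else real (n + 1) ^ (j - 1))"
  define Mk where "Mk k = M * 2 powr (- \<alpha> * real (Suc k))" for k
  have Mk: "0 \<le> Mk k" "Mk k \<le> M" for k
  proof -
    have "2 powr (- \<alpha> * real (Suc k)) \<le> 2 powr 0" using \<alpha> by (intro powr_mono) auto
    then show "0 \<le> Mk k" "Mk k \<le> M" using Suc.prems(2) by (auto simp: Mk_def mult_left_le)
  qed
  define Q where "Q k s c \<longleftrightarrow> (\<forall>t\<in>sparse_index j (n - Suc k). \<bar>c t\<bar> \<le> Mk k) \<and>
    (\<forall>x\<in>unit_cube d. \<bar>hier_slice j k s g x - (\<Sum>t\<in>sparse_index j (n - Suc k). c t * hat_prod t x)\<bar>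
       \<le> Mk k * 2 powr (- \<alpha> * real (n - Suc k)) * (if j = 0 then 0 else real (n - Suc k + 1) ^ (j - 1)))"
    for k s c
  have slice: "\<exists>c. Q k s c"
    if s: "s < 2 ^ k" for k s
  unfolding Q_def
  proof (rule Suc.IH)
    note nodes = dyadic_nodes[OF s]
    show "j \<le> d" "0 \<le> Mk k" using j Mk by auto
    show "mixed_bounded \<alpha> d j (Mk k) (hier_slice j k s g)"
      unfolding Mk_def by (rule mixed_bounded_slice[OF Suc.prems(3) j s])
    show "hier_slice j k s g y = 0" if "y \<in> unit_cube d" "i < j" "y i = 0 \<or> y i = 1" for y i
    proof -
      have "g (y(j := c)) = 0" if "0 \<le> c" "c \<le> 1" for c
        using that \<open>y \<in> unit_cube d\<close> \<open>i < j\<close> \<open>y i = 0 \<or> y i = 1\<close> j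
        by (intro Suc.prems(4)[of _ i] unit_cube_upd) auto
      then show ?thesis using nodes by (simp add: hier_slice_def hier_coeff_def)
    qed
    show "hier_slice j k s g y = hier_slice j k s g z"
      if "y \<in> unit_cube d" "z \<in> unit_cube d" "\<And>i. i < j \<Longrightarrow> y i = z i" for y z
    proof -
      have "g (y(j := c)) = g (z(j := c))" if "0 \<le> c" "c \<le> 1" for c
        using that \<open>y \<in> unit_cube d\<close> \<open>z \<in> unit_cube d\<close> \<open>\<And>i. i < j \<Longrightarrow> y i = z i\<close> j
        by (intro Suc.prems(5) unit_cube_upd) (auto simp: less_Suc_eq)
      then show ?thesis using nodes by (simp add: hier_slice_def hier_coeff_def)
    qed
  qed
  then have "\<forall>k s. \<exists>c. s < 2 ^ k \<longrightarrow> Q k s c" by blast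
  then obtain C where QC: "\<And>k s. s < 2 ^ k \<Longrightarrow> Q k s (C k s)" by metis
  define c where "c t = C (fst (hd t)) (snd (hd t)) (tl t)" for t
  have c1: "\<bar>c t\<bar> \<le> M" if tin: "t \<in> sparse_index (Suc j) n" for t
  proof -
    obtain k s t' where t: "t = (k, s) # t'" "s < 2 ^ k" "t' \<in> sparse_index j (n - Suc k)"
      using tin by auto
    then have "\<bar>c t\<bar> \<le> Mk k" using QC[of s k] by (simp add: c_def Q_def)
    also have "\<dots> \<le> M" by (rule Mk)
    finally show ?thesis .
  qed
  have c2: "\<bar>g x - (\<Sum>t\<in>sparse_index (Suc j) n. c t * hat_prod t x)\<bar>
      \<le> M * 2 powr (- \<alpha> * real n) * real (n + 1) ^ j" if x: "x \<in> unit_cube d" for x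
  proof -
    define R where "R k s = hier_slice j k s g x - (\<Sum>t\<in>sparse_index j (n - Suc k). C k s t * hat_prod t x)" for k s
    define P where "P = 2 powr (- \<alpha> * real n)"
    have "(\<Sum>t\<in>sparse_index (Suc j) n. c t * hat_prod t x) =
      (\<Sum>k<n. \<Sum>s<2 ^ k. \<Sum>t\<in>sparse_index j (n - Suc k). C k s t * (hat k s (x j) * hat_prod t x))"
      unfolding sum_sparse_index_Suc by (intro sum.cong refl) (simp add: c_def sparse_index_length)
    also have "\<dots> = (\<Sum>k<n. \<Sum>s<2 ^ k. (hier_slice j k s g x - R k s) * hat k s (x j))"
      by (intro sum.cong refl) (simp add: R_def sum_distrib_left sum_distrib_right mult_ac)
    also have "\<dots> = (\<Sum>k<n. \<Sum>s<2 ^ k. hier_slice j k s g x * hat k s (x j))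
         - (\<Sum>k<n. \<Sum>s<2 ^ k. R k s * hat k s (x j))"
      by (simp add: left_diff_distrib sum_subtractf)
    finally have "\<bar>g x - (\<Sum>t\<in>sparse_index (Suc j) n. c t * hat_prod t x)\<bar> \<le>
      \<bar>g x - (\<Sum>k<n. \<Sum>s<2 ^ k. hier_slice j k s g x * hat k s (x j))\<bar>
        + \<bar>\<Sum>k<n. \<Sum>s<2 ^ k. R k s * hat k s (x j)\<bar>" by linarith
    also have "\<dots> \<le> M * P + (\<Sum>k<n. M * P * E)"
    proof (rule add_mono)
      show "\<bar>g x - (\<Sum>k<n. \<Sum>s<2 ^ k. hier_slice j k s g x * hat k s (x j))\<bar> \<le> M * P"
        unfolding P_def using hier_interpolation_error[OF Suc.prems(3) j x Suc.prems(2) \<alpha> Suc.prems(4)] by simp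
      show "\<bar>\<Sum>k<n. \<Sum>s<2 ^ k. R k s * hat k s (x j)\<bar> \<le> (\<Sum>k<n. M * P * E)"
      proof (rule order_trans[OF sum_abs sum_mono])
        fix k assume k: "k \<in> {..<n}"
        have R: "\<bar>R k s\<bar> \<le> M * P * E" if "s < 2 ^ k" for s
        proof -
          have "\<bar>R k s\<bar> \<le> Mk k * 2 powr (- \<alpha> * real (n - Suc k)) * (if j = 0 then 0 else real (n - Suc k + 1) ^ (j - 1))"
            using QC[OF that] x unfolding R_def Q_def by blast
          also have "\<dots> \<le> Mk k * 2 powr (- \<alpha> * real (n - Suc k)) * E"
            unfolding E_def using Mk by (intro mult_left_mono) (auto intro!: power_mono)
          also have "Mk k * 2 powr (- \<alpha> * real (n - Suc k)) = M * P"
          proof -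
            have "- \<alpha> * real (Suc k) + - \<alpha> * real (n - Suc k) = - \<alpha> * real n"
              using k by (simp add: of_nat_diff algebra_simps)
            then show ?thesis unfolding Mk_def P_def by (simp only: mult.assoc powr_add[symmetric])
          qed
          finally show ?thesis .
        qed
        have "\<bar>\<Sum>s<2 ^ k. R k s * hat k s (x j)\<bar> \<le> (\<Sum>s<2 ^ k. M * P * E * hat k s (x j))"
          using R by (intro order_trans[OF sum_abs sum_mono]) (auto simp: abs_mult intro: mult_right_mono)
        also have "\<dots> = M * P * E * sawtooth k (x j)" by (simp add: sawtooth_def sum_distrib_left)
        also have "\<dots> \<le> M * P * E * 1"
          using Suc.prems(2) by (intro mult_left_mono sawtooth_le_1) (auto simp: E_def P_def)
        finally show "\<bar>\<Sum>s<2 ^ k. R k s * hat k s (x j)\<bar> \<le> M * P * E" by simp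
      qed
    qed
    also have "\<dots> = M * P * (1 + real n * E)" by (simp add: algebra_simps)
    also have "\<dots> \<le> M * P * real (n + 1) ^ j"
    proof (rule mult_left_mono)
      show "1 + real n * E \<le> real (n + 1) ^ j"
      proof (cases j)
        case (Suc i)
        have "1 \<le> real (n + 1) ^ i" by simp
        then show ?thesis using Suc by (simp add: E_def algebra_simps)
      qed (simp add: E_def)
    qed (use Suc.prems(2) in \<open>auto simp: P_def\<close>)
    finally show ?thesis by (simp add: P_def)
  qed
  show ?case using c1 c2 by (intro exI[of _ c]) auto
qed

lemma holder_ball0_mixed_bounded:
  assumes f: "f \<in> holder_ball0 \<alpha> d"
  shows "mixed_bounded \<alpha> d d 1 f"
  unfolding mixed_bounded_def
proof (intro allI impI ballI)
  fix u and h :: "nat \<Rightarrow> real" and x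
  assume u: "u \<subseteq> {..<d}" and h: "\<forall>i<d. 0 < h i" and x: "x \<in> shift_cube d h u"
  let ?p = "\<Prod>i\<in>u. h i powr (- \<alpha>)"
  have "ennreal (?p * \<bar>mixed_diff h u f x\<bar>) = ennreal ?p * ennreal \<bar>mixed_diff h u f x\<bar>"
    by (intro ennreal_mult prod_nonneg) auto
  also have "\<dots> \<le> ennreal ?p * (SUP x\<in>shift_cube d h u. ennreal \<bar>mixed_diff h u f x\<bar>)"
    using x by (intro mult_left_mono SUP_upper) auto
  also have "\<dots> \<le> holder_seminorm \<alpha> d u f"
    unfolding holder_seminorm_def using h
    by (intro SUP_upper[of h _ "\<lambda>h. ennreal (\<Prod>i\<in>u. h i powr (- \<alpha>)) *
        (SUP x\<in>shift_cube d h u. ennreal \<bar>mixed_diff h u f x\<bar>)"]) auto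
  also have "\<dots> \<le> holder_norm \<alpha> d f" unfolding holder_norm_def using u by (intro Max_ge) auto
  also have "\<dots> \<le> ennreal 1" using f by (simp add: holder_ball0_def)
  finally have "?p * \<bar>mixed_diff h u f x\<bar> \<le> 1" by (simp only: ennreal_le_iff zero_le_one)
  moreover have pos: "0 < (\<Prod>i\<in>u. h i powr \<alpha>)" using h u by (intro prod_pos) auto
  moreover have "?p = inverse (\<Prod>i\<in>u. h i powr \<alpha>)" by (simp add: powr_minus prod_inversef[symmetric] o_def)
  ultimately show "\<bar>mixed_diff h u f x\<bar> \<le> 1 * (\<Prod>i\<in>u. h i powr \<alpha>)" by (simp add: field_simps)
qed

lemma holder_ball0_sparse_grid:
  assumes "0 < \<alpha>" "0 < d" "f \<in> holder_ball0 \<alpha> d"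
  obtains c where "\<And>t. t \<in> sparse_index d n \<Longrightarrow> \<bar>c t\<bar> \<le> 1"
    "\<And>x. x \<in> unit_cube d \<Longrightarrow> \<bar>f x - (\<Sum>t\<in>sparse_index d n. c t * hat_prod t x)\<bar>
       \<le> 2 powr (- \<alpha> * real n) * real (n + 1) ^ (d - 1)"
proof -
  have "\<exists>c. (\<forall>t\<in>sparse_index d n. \<bar>c t\<bar> \<le> 1) \<and>
    (\<forall>x\<in>unit_cube d. \<bar>f x - (\<Sum>t\<in>sparse_index d n. c t * hat_prod t x)\<bar>
       \<le> 1 * 2 powr (- \<alpha> * real n) * (if d = 0 then 0 else real (n + 1) ^ (d - 1)))"
  proof (rule sparse_grid_approx)
    show "mixed_bounded \<alpha> d d 1 f" by (rule holder_ball0_mixed_bounded[OF assms(3)])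
    show "f y = 0" if "y \<in> unit_cube d" "i < d" "y i = 0 \<or> y i = 1" for y i
    proof -
      have "y \<in> unit_cube_boundary d" using that by (auto simp: unit_cube_boundary_def)
      then show ?thesis using assms(3) by (simp add: holder_ball0_def cont_zero_boundary_def)
    qed
    show "f y = f z" if "y \<in> unit_cube d" "z \<in> unit_cube d" "\<And>i. i < d \<Longrightarrow> y i = z i" for y z
      using that PiE_ext[of y "{..<d}" "\<lambda>_. {0..1}" z] by (simp add: unit_cube_def)
  qed (use assms in auto)
  then show thesis using that assms(2) by auto
qed

subsection \<open>Networks as layers of feature sets\<close>

text \<open>\<open>w\<close> bounds the number of weights in one matrix row. The bias is charged
  separately, as the \<open>+ 1\<close> per neuron in \<open>relu_layer\<close>.\<close>

definition affine_in ::
    "((nat \<Rightarrow> real) \<Rightarrow> real) set \<Rightarrow> nat \<Rightarrow> ((nat \<Rightarrow> real) \<Rightarrow> real) \<Rightarrow> bool" where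
  "affine_in \<F> w g \<longleftrightarrow> (\<exists>A c b. finite A \<and> A \<subseteq> \<F> \<and> card A \<le> w \<and> g = (\<lambda>x. b + (\<Sum>F\<in>A. c F * F x)))"

lemma affine_in_mono:
  assumes "affine_in \<F> w g" "\<F> \<subseteq> \<G>" "w \<le> v"
  shows "affine_in \<G> v g"
proof -
  obtain A c b where "finite A" "A \<subseteq> \<F>" "card A \<le> w" "g = (\<lambda>x. b + (\<Sum>F\<in>A. c F * F x))"
    using assms(1) unfolding affine_in_def by blast
  then show ?thesis unfolding affine_in_def using assms(2,3)
    by (intro exI[of _ A] exI[of _ c] exI[of _ b]) auto
qed

text \<open>The indexing need not be injective: coefficients of coinciding features are added, which
  can only lower the number of weights.\<close>

lemma affine_in_sum:
  assumes "finite T" "F ` T \<subseteq> \<F>"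
  shows "affine_in \<F> (card T) (\<lambda>x. b + (\<Sum>t\<in>T. c t * F t x))"
proof -
  define C where "C G = (\<Sum>t | t \<in> T \<and> F t = G. c t)" for G
  have "(\<Sum>t\<in>T. c t * F t x) = (\<Sum>G\<in>F ` T. C G * G x)" for x
  proof -
    have "(\<Sum>t\<in>T. c t * F t x) = (\<Sum>G\<in>F ` T. \<Sum>t | t \<in> T \<and> F t = G. c t * F t x)"
      by (rule sum.image_gen[OF assms(1)])
    also have "\<dots> = (\<Sum>G\<in>F ` T. C G * G x)"
      by (rule sum.cong) (auto simp: C_def sum_distrib_right)
    finally show ?thesis .
  qed
  then have "(\<lambda>x. b + (\<Sum>t\<in>T. c t * F t x)) = (\<lambda>x. b + (\<Sum>G\<in>F ` T. C G * G x))" by simp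
  then show ?thesis
    unfolding affine_in_def using assms card_image_le by (intro exI[of _ "F ` T"] exI[of _ C] exI[of _ b]) auto
qed

lemma affine_in_const: "affine_in \<F> 0 (\<lambda>x. b)"
  unfolding affine_in_def by (rule exI[of _ "{}"]) auto

lemma affine_in_base:
  assumes "F \<in> \<F>"
  shows "affine_in \<F> 1 (\<lambda>x. c * F x)"
  unfolding affine_in_def using assms by (intro exI[of _ "{F}"] exI[of _ "\<lambda>_. c"] exI[of _ 0]) auto

lemma affine_in_add:
  assumes "affine_in \<F> w g" "affine_in \<F> v h"
  shows "affine_in \<F> (w + v) (\<lambda>x. g x + h x)"
proof -
  obtain A c b where g: "finite A" "A \<subseteq> \<F>" "card A \<le> w" "g = (\<lambda>x. b + (\<Sum>F\<in>A. c F * F x))"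
    using assms(1) unfolding affine_in_def by blast
  obtain A' c' b' where h: "finite A'" "A' \<subseteq> \<F>" "card A' \<le> v" "h = (\<lambda>x. b' + (\<Sum>F\<in>A'. c' F * F x))"
    using assms(2) unfolding affine_in_def by blast
  define e where "e F = (if F \<in> A then c F else 0) + (if F \<in> A' then c' F else 0)" for F
  have "(\<Sum>F\<in>A \<union> A'. e F * F x) = (\<Sum>F\<in>A. c F * F x) + (\<Sum>F\<in>A'. c' F * F x)" for x
  proof -
    have "(\<Sum>F\<in>A \<union> A'. e F * F x) = (\<Sum>F\<in>A \<union> A'. (if F \<in> A then c F * F x else 0))
        + (\<Sum>F\<in>A \<union> A'. (if F \<in> A' then c' F * F x else 0))"
      unfolding sum.distrib[symmetric] by (intro sum.cong) (auto simp: e_def algebra_simps)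
    then show ?thesis using g(1) h(1) by (simp add: sum.If_cases Int_Un_distrib2 Int_absorb1 Un_Int_eq)
  qed
  then have "(\<lambda>x. g x + h x) = (\<lambda>x. (b + b') + (\<Sum>F\<in>A \<union> A'. e F * F x))"
    by (simp add: g(4) h(4) algebra_simps)
  moreover have "card (A \<union> A') \<le> w + v" using card_Un_le[of A A'] g(3) h(3) by linarith
  ultimately show ?thesis unfolding affine_in_def using g h
    by (intro exI[of _ "A \<union> A'"] exI[of _ e] exI[of _ "b + b'"]) auto
qed

text \<open>\<open>S\<close> bounds the nonzero weights and biases of one layer. The row bound
  varies with the neuron, since copied features and wide sums stand side by side.\<close>

definition relu_layer ::
    "((nat \<Rightarrow> real) \<Rightarrow> real) set \<Rightarrow> nat \<Rightarrow> ((nat \<Rightarrow> real) \<Rightarrow> real) set \<Rightarrow> bool" where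
  "relu_layer \<F> S \<G> \<longleftrightarrow> finite \<G> \<and>
     (\<exists>w. (\<forall>G\<in>\<G>. \<exists>g. affine_in \<F> (w G) g \<and> G = (\<lambda>x. relu (g x))) \<and> (\<Sum>G\<in>\<G>. w G + 1) \<le> S)"

lemma relu_layer_mono: "relu_layer \<F> S \<G> \<Longrightarrow> S \<le> S' \<Longrightarrow> relu_layer \<F> S' \<G>"
  unfolding relu_layer_def by (meson order_trans)

lemma relu_layer_image:
  assumes "finite I" "\<And>\<iota>. \<iota> \<in> I \<Longrightarrow> affine_in \<F> w (g \<iota>)"
  shows "relu_layer \<F> (card I * (w + 1)) ((\<lambda>\<iota> x. relu (g \<iota> x)) ` I)"
proof -
  have "card ((\<lambda>\<iota> x. relu (g \<iota> x)) ` I) * (w + 1) \<le> card I * (w + 1)"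
    by (intro mult_right_mono card_image_le assms(1)) simp
  then show ?thesis unfolding relu_layer_def using assms by (intro conjI exI[of _ "\<lambda>_. w"]) auto
qed

text \<open>Rectification is the identity on nonnegative features, so they pass to the next layer
  for one weight each; the other unit is the allowance for a bias.\<close>

lemma relu_layer_keep:
  assumes "finite \<H>" "\<H> \<subseteq> \<F>" "\<And>F x. F \<in> \<H> \<Longrightarrow> 0 \<le> F x"
  shows "relu_layer \<F> (2 * card \<H>) \<H>"
proof -
  have "relu_layer \<F> (card \<H> * (1 + 1)) ((\<lambda>F x. relu (1 * F x)) ` \<H>)"
    using assms by (intro relu_layer_image affine_in_base) auto
  moreover have "(\<lambda>F x. relu (1 * F x)) ` \<H> = \<H>"
  proof -
    have "(\<lambda>x. relu (1 * F x)) = F" if "F \<in> \<H>" for F using assms(3)[OF that] by auto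
    then show ?thesis by (simp add: image_cong[of \<H> \<H> _ id])
  qed
  ultimately show ?thesis by (simp add: mult_2)
qed

lemma relu_layer_Un:
  assumes "relu_layer \<F> S \<G>" "relu_layer \<F> T \<H>"
  shows "relu_layer \<F> (S + T) (\<G> \<union> \<H>)"
proof -
  obtain w where w: "finite \<G>" "\<And>G. G \<in> \<G> \<Longrightarrow> \<exists>g. affine_in \<F> (w G) g \<and> G = (\<lambda>x. relu (g x))"
      "(\<Sum>G\<in>\<G>. w G + 1) \<le> S"
    using assms(1) unfolding relu_layer_def by blast
  obtain v where v: "finite \<H>" "\<And>G. G \<in> \<H> \<Longrightarrow> \<exists>g. affine_in \<F> (v G) g \<and> G = (\<lambda>x. relu (g x))"
      "(\<Sum>G\<in>\<H>. v G + 1) \<le> T"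
    using assms(2) unfolding relu_layer_def by blast
  \<comment> \<open>A function in both sets gets a single neuron, charged with the bound from
    \<open>\<G>\<close>.\<close>
  define u where "u G = (if G \<in> \<G> then w G else v G)" for G
  have "(\<Sum>G\<in>\<G> \<union> \<H>. u G + 1) = (\<Sum>G\<in>\<G>. u G + 1) + (\<Sum>G\<in>\<H> - \<G>. u G + 1)"
    using w(1) v(1) by (subst Un_Diff_cancel[symmetric], subst sum.union_disjoint) auto
  also have "\<dots> = (\<Sum>G\<in>\<G>. w G + 1) + (\<Sum>G\<in>\<H> - \<G>. v G + 1)"
    by (intro arg_cong2[where f = plus] sum.cong) (auto simp: u_def)
  also have "\<dots> \<le> (\<Sum>G\<in>\<G>. w G + 1) + (\<Sum>G\<in>\<H>. v G + 1)"
    using v(1) by (intro add_left_mono sum_mono2) auto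
  finally have "(\<Sum>G\<in>\<G> \<union> \<H>. u G + 1) \<le> S + T" using w(3) v(3) by linarith
  then show ?thesis unfolding relu_layer_def using w(1,2) v(1,2)
    by (intro conjI exI[of _ u]) (auto simp: u_def)
qed

section \<open>From layers of features to networks\<close>

text \<open>Unlike \<open>net_eval\<close> this rectifies after the last layer too; in this form a
  network can grow by appending layers at its end.\<close>

fun hidden_eval :: "network \<Rightarrow> real vec \<Rightarrow> real vec" where
  "hidden_eval [] z = z"
| "hidden_eval ((W, b) # \<Phi>) z = hidden_eval \<Phi> (map_vec relu (W *\<^sub>v z + b))"

lemma hidden_eval_snoc:
  "hidden_eval (\<Phi> @ [(W, b)]) z = map_vec relu (W *\<^sub>v hidden_eval \<Phi> z + b)"
  by (induction \<Phi> z rule: hidden_eval.induct) auto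

lemma net_eval_snoc:
  "net_eval (\<Phi> @ [(W, b)]) z = W *\<^sub>v hidden_eval \<Phi> z + b"
proof (induction \<Phi> z rule: hidden_eval.induct)
  case (2 V a \<Phi> z)
  then show ?case by (cases \<Phi>) auto
qed simp

text \<open>The features form a set, so neurons that compute the same function are merged and the
  families of neurons below need not be injectively indexed.\<close>

definition hidden_features :: "nat \<Rightarrow> nat \<Rightarrow> ((nat \<Rightarrow> real) \<Rightarrow> real) set \<Rightarrow> nat \<Rightarrow> bool" where
  "hidden_features d l \<F> S \<longleftrightarrow> (\<exists>\<Phi> N fs. length \<Phi> = l \<and> N 0 = d \<and> net_size \<Phi> \<le> S \<and>
     (\<forall>i<l. N (Suc i) \<ge> 1 \<and> fst (\<Phi> ! i) \<in> carrier_mat (N (Suc i)) (N i) \<and>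
        snd (\<Phi> ! i) \<in> carrier_vec (N (Suc i))) \<and>
     length fs = N l \<and> set fs = \<F> \<and> distinct fs \<and>
     (\<forall>x. hidden_eval \<Phi> (Matrix.vec d x) = Matrix.vec (N l) (\<lambda>j. (fs ! j) x)))"

lemma hidden_features_mono:
  assumes "hidden_features d l \<F> S" "S \<le> S'" "l = l'"
  shows "hidden_features d l' \<F> S'"
proof -
  obtain \<Phi> N fs where *: "length \<Phi> = l \<and> N 0 = d \<and> net_size \<Phi> \<le> S \<and>
     (\<forall>i<l. N (Suc i) \<ge> 1 \<and> fst (\<Phi> ! i) \<in> carrier_mat (N (Suc i)) (N i) \<and>
        snd (\<Phi> ! i) \<in> carrier_vec (N (Suc i))) \<and>
     length fs = N l \<and> set fs = \<F> \<and> distinct fs \<and>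
     (\<forall>x. hidden_eval \<Phi> (Matrix.vec d x) = Matrix.vec (N l) (\<lambda>j. (fs ! j) x))"
    using assms(1) unfolding hidden_features_def by blast
  then have "net_size \<Phi> \<le> S'" using assms(2) by linarith
  with * show ?thesis unfolding assms(3)[symmetric] hidden_features_def by blast
qed

lemma hidden_features_input: "hidden_features d 0 ((\<lambda>i x. x i) ` {..<d}) 0"
proof -
  have "distinct (map (\<lambda>i x. x i :: real) [0..<d])"
  proof -
    have "inj (\<lambda>(i::nat) x. x i :: real)"
    proof (rule injI)
      fix i j :: nat assume "(\<lambda>x. x i :: real) = (\<lambda>x. x j)"
      from fun_cong[OF this, of "\<lambda>k. if k = i then 1 else 0"] show "i = j" by (auto split: if_splits)
    qed
    then have "inj_on (\<lambda>(i::nat) x. x i :: real) {0..<d}" by (rule inj_on_subset) simp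
    then show ?thesis by (simp add: distinct_map)
  qed
  then show ?thesis unfolding hidden_features_def
    by (intro exI[of _ "[]"] exI[of _ "\<lambda>_. d"] exI[of _ "map (\<lambda>i x. x i) [0..<d]"])
      (auto simp: net_size_def lessThan_atLeast0 intro!: eq_vecI)
qed

lemma net_size_snoc:
  "net_size (\<Phi> @ [(W, b)]) = net_size \<Phi> +
     (card {(i, j). i < dim_row W \<and> j < dim_col W \<and> W $$ (i, j) \<noteq> 0} + card {i. i < dim_vec b \<and> b $ i \<noteq> 0})"
  by (simp add: net_size_def)

text \<open>Distinctness of \<open>fs\<close> turns a sum over columns into a sum over features and
  keeps the nonzero entries of a row within the cardinality of its feature set.\<close>

lemma affine_features_matrix:
  assumes fs: "distinct fs" and gs: "distinct gs"
    and G: "\<And>G. G \<in> set gs \<Longrightarrow> affine_in (set fs) (w G) (g G)"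
  shows "\<exists>W b. W \<in> carrier_mat (length gs) (length fs) \<and> b \<in> carrier_vec (length gs) \<and>
    (\<forall>x. W *\<^sub>v Matrix.vec (length fs) (\<lambda>j. (fs ! j) x) + b = Matrix.vec (length gs) (\<lambda>i. g (gs ! i) x)) \<and>
    card {(i, j). i < dim_row W \<and> j < dim_col W \<and> W $$ (i, j) \<noteq> 0} + card {i. i < dim_vec b \<and> b $ i \<noteq> 0}
      \<le> (\<Sum>G\<in>set gs. w G + 1)"
proof -
  let ?m = "length gs" and ?n = "length fs"
  define P where "P G A c b \<longleftrightarrow> finite A \<and> A \<subseteq> set fs \<and> card A \<le> w G \<and>
    g G = (\<lambda>x. b + (\<Sum>F\<in>A. c F * F x))" for G A c b
  have "\<exists>A c b. P G A c b" if "G \<in> set gs" for G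
    using G[OF that] unfolding affine_in_def P_def by blast
  then obtain A c \<beta> where P: "\<And>G. G \<in> set gs \<Longrightarrow> P G (A G) (c G) (\<beta> G)" by metis
  then have A: "\<And>G. G \<in> set gs \<Longrightarrow> finite (A G)" "\<And>G. G \<in> set gs \<Longrightarrow> A G \<subseteq> set fs"
    "\<And>G. G \<in> set gs \<Longrightarrow> card (A G) \<le> w G" "\<And>G. G \<in> set gs \<Longrightarrow> g G = (\<lambda>x. \<beta> G + (\<Sum>F\<in>A G. c G F * F x))"
    unfolding P_def by blast+
  define W where "W = Matrix.mat ?m ?n (\<lambda>(i, j). if fs ! j \<in> A (gs ! i) then c (gs ! i) (fs ! j) else 0)"
  define b where "b = Matrix.vec ?m (\<lambda>i. \<beta> (gs ! i))"
  have "W *\<^sub>v Matrix.vec ?n (\<lambda>j. (fs ! j) x) + b = Matrix.vec ?m (\<lambda>i. g (gs ! i) x)" for x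
  proof (rule eq_vecI)
    fix i assume "i < dim_vec (Matrix.vec ?m (\<lambda>i. g (gs ! i) x))"
    then have i: "i < ?m" by simp
    define G where "G = gs ! i"
    have Gin: "G \<in> set gs" using i by (simp add: G_def)
    have "(W *\<^sub>v Matrix.vec ?n (\<lambda>j. (fs ! j) x)) $ i =
        (\<Sum>j\<in>{0..<?n}. (if fs ! j \<in> A G then c G (fs ! j) else 0) * (fs ! j) x)"
      using i by (simp add: W_def G_def scalar_prod_def cong: if_cong)
    also have "\<dots> = (\<Sum>F\<in>set fs. (if F \<in> A G then c G F else 0) * F x)"
      using bij_betw_nth[OF fs, of "{0..<?n}" "set fs"]
      by (intro sum.reindex_bij_betw[where h = "\<lambda>j. fs ! j" and g = "\<lambda>F. (if F \<in> A G then c G F else 0) * F x"])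
        (simp add: lessThan_atLeast0)
    also have "\<dots> = (\<Sum>F\<in>A G. c G F * F x)"
      using A(2)[OF Gin] by (intro sum.mono_neutral_cong_right) auto
    finally show "(W *\<^sub>v Matrix.vec ?n (\<lambda>j. (fs ! j) x) + b) $ i = Matrix.vec ?m (\<lambda>i. g (gs ! i) x) $ i"
      using i A(4)[OF Gin] by (simp add: b_def W_def G_def)
  qed (simp add: b_def)
  moreover have "card {(i, j). i < dim_row W \<and> j < dim_col W \<and> W $$ (i, j) \<noteq> 0} + card {i. i < dim_vec b \<and> b $ i \<noteq> 0}
      \<le> (\<Sum>G\<in>set gs. w G + 1)"
  proof -
    have "{(i, j). i < dim_row W \<and> j < dim_col W \<and> W $$ (i, j) \<noteq> 0} \<subseteq>
        (SIGMA i:{..<?m}. {j. j < ?n \<and> fs ! j \<in> A (gs ! i)})"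
      by (auto simp: W_def split: if_splits)
    then have "card {(i, j). i < dim_row W \<and> j < dim_col W \<and> W $$ (i, j) \<noteq> 0} \<le>
        card (SIGMA i:{..<?m}. {j. j < ?n \<and> fs ! j \<in> A (gs ! i)})"
      by (intro card_mono finite_SigmaI) auto
    also have "\<dots> = (\<Sum>i<?m. card {j. j < ?n \<and> fs ! j \<in> A (gs ! i)})" by (intro card_SigmaI) auto
    also have "\<dots> \<le> (\<Sum>i<?m. w (gs ! i))"
    proof (rule sum_mono)
      fix i assume i: "i \<in> {..<?m}"
      have "card {j. j < ?n \<and> fs ! j \<in> A (gs ! i)} \<le> card (A (gs ! i))"
        using fs i A(1) by (intro card_inj_on_le[where f = "\<lambda>j. fs ! j"]) (auto simp: inj_on_def nth_eq_iff_index_eq)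
      also have "\<dots> \<le> w (gs ! i)" using i A(3) by simp
      finally show "card {j. j < ?n \<and> fs ! j \<in> A (gs ! i)} \<le> w (gs ! i)" .
    qed
    finally have 1: "card {(i, j). i < dim_row W \<and> j < dim_col W \<and> W $$ (i, j) \<noteq> 0} \<le> (\<Sum>i<?m. w (gs ! i))" .
    have "card {i. i < dim_vec b \<and> b $ i \<noteq> 0} \<le> card {..<?m}"
      by (intro card_mono) (auto simp: b_def)
    then have 2: "card {i. i < dim_vec b \<and> b $ i \<noteq> 0} \<le> (\<Sum>i<?m. 1)" by simp
    have eq: "(\<Sum>i<?m. w (gs ! i) + 1) = (\<Sum>G\<in>set gs. w G + 1)"
      using bij_betw_nth[OF gs, of "{..<?m}" "set gs"] by (intro sum.reindex_bij_betw) auto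
    show ?thesis using add_mono[OF 1 2] unfolding sum.distrib[symmetric] eq .
  qed
  ultimately show ?thesis by (intro exI[of _ W] exI[of _ b]) (simp add: W_def b_def)
qed

lemma hidden_features_step:
  assumes F: "hidden_features d l \<F> S" and G: "relu_layer \<F> T \<G>" "\<G> \<noteq> {}"
  shows "hidden_features d (Suc l) \<G> (S + T)"
proof -
  obtain \<Phi> N fs where \<Phi>: "length \<Phi> = l" "N 0 = d" "net_size \<Phi> \<le> S"
     "\<And>i. i < l \<Longrightarrow> N (Suc i) \<ge> 1 \<and> fst (\<Phi> ! i) \<in> carrier_mat (N (Suc i)) (N i) \<and>
        snd (\<Phi> ! i) \<in> carrier_vec (N (Suc i))"
     "length fs = N l" "set fs = \<F>" "distinct fs"
     "\<And>x. hidden_eval \<Phi> (Matrix.vec d x) = Matrix.vec (N l) (\<lambda>j. (fs ! j) x)"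
    using F unfolding hidden_features_def by blast
  obtain w where w: "finite \<G>" "\<And>G. G \<in> \<G> \<Longrightarrow> \<exists>g. affine_in \<F> (w G) g \<and> G = (\<lambda>x. relu (g x))"
      "(\<Sum>G\<in>\<G>. w G + 1) \<le> T"
    using G(1) unfolding relu_layer_def by blast
  obtain g where g: "\<And>G. G \<in> \<G> \<Longrightarrow> affine_in \<F> (w G) (g G)" "\<And>G x. G \<in> \<G> \<Longrightarrow> G x = relu (g G x)"
    using w(2) by metis
  obtain gs where gs: "set gs = \<G>" "distinct gs" using finite_distinct_list[OF w(1)] by blast
  have G': "\<And>G. G \<in> set gs \<Longrightarrow> affine_in (set fs) (w G) (g G)" using g(1) gs(1) \<Phi>(6) by simp
  obtain W b where W: "W \<in> carrier_mat (length gs) (N l)" "b \<in> carrier_vec (length gs)"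
    "\<And>x. W *\<^sub>v Matrix.vec (N l) (\<lambda>j. (fs ! j) x) + b = Matrix.vec (length gs) (\<lambda>i. g (gs ! i) x)"
    "card {(i, j). i < dim_row W \<and> j < dim_col W \<and> W $$ (i, j) \<noteq> 0} + card {i. i < dim_vec b \<and> b $ i \<noteq> 0}
      \<le> (\<Sum>G\<in>\<G>. w G + 1)"
    using affine_features_matrix[where w = w and g = g, OF \<Phi>(7) gs(2) G', unfolded \<Phi>(5) gs(1)] by blast
  define N' where "N' = N(Suc l := length gs)"
  have "hidden_eval (\<Phi> @ [(W, b)]) (Matrix.vec d x) = Matrix.vec (N' (Suc l)) (\<lambda>j. (gs ! j) x)" for x
    unfolding hidden_eval_snoc \<Phi>(8) W(3) N'_def by (rule eq_vecI) (auto simp: g(2) gs(1)[symmetric])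
  moreover have "net_size (\<Phi> @ [(W, b)]) \<le> S + T"
    unfolding net_size_snoc using \<Phi>(3) W(4) w(3) by linarith
  moreover have "N' (Suc i) \<ge> 1 \<and> fst ((\<Phi> @ [(W, b)]) ! i) \<in> carrier_mat (N' (Suc i)) (N' i) \<and>
        snd ((\<Phi> @ [(W, b)]) ! i) \<in> carrier_vec (N' (Suc i))" if "i < Suc l" for i
  proof (cases "i = l")
    case True
    have "1 \<le> length gs" using gs(1) G(2) by (cases gs) auto
    then show ?thesis using True W \<Phi>(1) by (auto simp: N'_def)
  next
    case False
    then show ?thesis using that \<Phi>(1) \<Phi>(4)[of i] by (auto simp: N'_def nth_append)
  qed
  ultimately show ?thesis unfolding hidden_features_def using \<Phi>(1,2) gs
    by (intro exI[of _ "\<Phi> @ [(W, b)]"] exI[of _ N'] exI[of _ gs]) (auto simp: N'_def)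
qed

lemma hidden_features_output:
  assumes F: "hidden_features d l \<F> S" and g: "affine_in \<F> w g" and "1 \<le> l"
  shows "\<exists>\<Phi>. is_network d 1 \<Phi> \<and> net_depth \<Phi> = Suc l \<and> net_size \<Phi> \<le> S + w + 1 \<and> net_fun d \<Phi> = g"
proof -
  obtain \<Phi> N fs where \<Phi>: "length \<Phi> = l" "N 0 = d" "net_size \<Phi> \<le> S"
     "\<And>i. i < l \<Longrightarrow> N (Suc i) \<ge> 1 \<and> fst (\<Phi> ! i) \<in> carrier_mat (N (Suc i)) (N i) \<and>
        snd (\<Phi> ! i) \<in> carrier_vec (N (Suc i))"
     "length fs = N l" "set fs = \<F>" "distinct fs"
     "\<And>x. hidden_eval \<Phi> (Matrix.vec d x) = Matrix.vec (N l) (\<lambda>j. (fs ! j) x)"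
    using F unfolding hidden_features_def by blast
  have dg: "distinct [g]" by simp
  have g': "\<And>G. G \<in> set [g] \<Longrightarrow> affine_in (set fs) w g" using g \<Phi>(6) by simp
  obtain W b where W: "W \<in> carrier_mat (length [g]) (N l)" "b \<in> carrier_vec (length [g])"
    "\<And>x. W *\<^sub>v Matrix.vec (N l) (\<lambda>j. (fs ! j) x) + b = Matrix.vec (length [g]) (\<lambda>i. g x)"
    "card {(i, j). i < dim_row W \<and> j < dim_col W \<and> W $$ (i, j) \<noteq> 0} + card {i. i < dim_vec b \<and> b $ i \<noteq> 0}
      \<le> (\<Sum>G\<in>set [g]. w + 1)"
    using affine_features_matrix[OF \<Phi>(7) dg, of "\<lambda>_. w" "\<lambda>_. g", unfolded \<Phi>(5)] g' by blast
  define N' where "N' = N(Suc l := 1)"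
  have "N' (Suc i) \<ge> 1 \<and> fst ((\<Phi> @ [(W, b)]) ! i) \<in> carrier_mat (N' (Suc i)) (N' i) \<and>
        snd ((\<Phi> @ [(W, b)]) ! i) \<in> carrier_vec (N' (Suc i))" if "i < Suc l" for i
  proof (cases "i = l")
    case True
    then show ?thesis using W \<Phi>(1) by (auto simp: N'_def)
  next
    case False
    then show ?thesis using that \<Phi>(1) \<Phi>(4)[of i] by (auto simp: N'_def nth_append)
  qed
  then have "is_network d 1 (\<Phi> @ [(W, b)])"
    unfolding is_network_def net_depth_def using \<Phi>(1,2) assms(3) by (auto simp: N'_def intro!: exI[of _ N'])
  moreover have "net_size (\<Phi> @ [(W, b)]) \<le> S + w + 1"
    unfolding net_size_snoc using \<Phi>(3) W(4) by simp
  moreover have "net_fun d (\<Phi> @ [(W, b)]) = g"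
    unfolding net_fun_def net_eval_snoc \<Phi>(8) W(3) by simp
  ultimately show ?thesis using \<Phi>(1) by (auto simp: net_depth_def)
qed

subsection \<open>The sparse grid network\<close>

definition hat_index :: "nat \<Rightarrow> nat \<Rightarrow> (nat \<times> nat \<times> nat) set" where
  "hat_index d n = {..<d} \<times> (SIGMA k:{..<n}. {..<2 ^ k})"

definition hat_features :: "nat \<Rightarrow> nat \<Rightarrow> ((nat \<Rightarrow> real) \<Rightarrow> real) set" where
  "hat_features d n = (\<lambda>(i, k, s) x. hat k s (x i)) ` hat_index d n"

definition sawtooth_features :: "nat \<Rightarrow> nat \<Rightarrow> ((nat \<Rightarrow> real) \<Rightarrow> real) set" where
  "sawtooth_features d n = (\<lambda>(i, k) x. sawtooth k (x i)) ` ({..<d} \<times> {..<n})"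

text \<open>The total level is not restricted here: there are only \<open>n ^ j\<close> such lists,
  negligible against \<open>2 ^ n\<close>, and the product layers need no bookkeeping of
  budgets.\<close>

definition level_lists :: "nat \<Rightarrow> nat \<Rightarrow> nat list set" where
  "level_lists n j = {t. set t \<subseteq> {..<n} \<and> length t = j}"

definition prod_features :: "nat \<Rightarrow> nat \<Rightarrow> nat \<Rightarrow> ((nat \<Rightarrow> real) \<Rightarrow> real) set" where
  "prod_features N n j = approx_saw_prod N ` level_lists n j"

text \<open>Carried along through all product layers: sawtooths are the next factors, and both kinds
  are needed for the support gaps at the end.\<close>

definition base_features :: "nat \<Rightarrow> nat \<Rightarrow> ((nat \<Rightarrow> real) \<Rightarrow> real) set" where
  "base_features d n = hat_features d n \<union> sawtooth_features d n"

lemma finite_hat_index [simp]: "finite (hat_index d n)"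
  by (simp add: hat_index_def)

lemma card_hat_index: "card (hat_index d n) \<le> d * 2 ^ n"
proof -
  have "card (SIGMA k:{..<n}. {..<(2::nat) ^ k}) = (\<Sum>k<n. 2 ^ k)" by simp
  also have "\<dots> = 2 ^ n - 1" by (induction n) auto
  finally show ?thesis unfolding hat_index_def by (simp add: card_cartesian_product)
qed

lemma finite_level_lists [simp]: "finite (level_lists n j)"
  by (simp add: level_lists_def finite_lists_length_eq)

lemma card_level_lists: "card (level_lists n j) = n ^ j"
  by (simp add: level_lists_def card_lists_length_eq)

lemma level_lists_Suc: "level_lists n (Suc j) = (\<lambda>(k, t). k # t) ` ({..<n} \<times> level_lists n j)"
  by (auto simp: level_lists_def length_Suc_conv image_iff)

lemma base_features_finite: "finite (base_features d n)"
  by (simp add: base_features_def hat_features_def sawtooth_features_def)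

lemma base_features_nonneg: "F \<in> base_features d n \<Longrightarrow> 0 \<le> F x"
  by (auto simp: base_features_def hat_features_def sawtooth_features_def)

lemma card_hat_features: "card (hat_features d n) \<le> d * 2 ^ n"
  unfolding hat_features_def using card_image_le[OF finite_hat_index] card_hat_index order_trans by blast

lemma card_base_features: "card (base_features d n) \<le> 2 * (d * 2 ^ n)"
proof -
  have "card (sawtooth_features d n) \<le> d * n"
    unfolding sawtooth_features_def using card_image_le[of "{..<d} \<times> {..<n}"] by (simp add: card_cartesian_product)
  also have "\<dots> \<le> d * 2 ^ n" by (intro mult_left_mono) (auto intro: less_imp_le)
  finally show ?thesis
    using card_Un_le[of "hat_features d n" "sawtooth_features d n"] card_hat_features[of d n]
    unfolding base_features_def by linarith
qed

lemma hat_in_base: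
  assumes "i < d" "k < n" "s < 2 ^ k"
  shows "(\<lambda>x. hat k s (x i)) \<in> base_features d n"
proof -
  have "(i, k, s) \<in> hat_index d n" using assms by (simp add: hat_index_def)
  then show ?thesis unfolding base_features_def hat_features_def by force
qed

lemma sawtooth_in_base: "i < d \<Longrightarrow> k < n \<Longrightarrow> (\<lambda>x. sawtooth k (x i)) \<in> base_features d n"
  unfolding base_features_def sawtooth_features_def by force

text \<open>An absolute value is \<open>relu u + relu (- u)\<close>, hence two layers;
  \<open>\<sigma>\<close> selects the half. Per index the halves take a weight and a bias each and
  the outer neuron two weights and a bias, which makes 7.\<close>

lemma hidden_hat_features:
  assumes "0 < d" "0 < n"
  shows "hidden_features d 2 (hat_features d n) (7 * (d * 2 ^ n))"
proof -
  define U where "U = (\<lambda>((i, k, s), \<sigma>) (x :: nat \<Rightarrow> real). - (\<sigma> * (2 * real s + 1)) + (\<sigma> * 2 ^ Suc k) * x i)"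
  let ?I = "hat_index d n \<times> {1, -1 :: real}"
  let ?V = "(\<lambda>\<iota> x. relu (U \<iota> x)) ` ?I"
  have ne: "hat_index d n \<noteq> {}"
  proof -
    have "(0, 0, 0) \<in> hat_index d n" using assms by (simp add: hat_index_def)
    then show ?thesis by blast
  qed
  have 1: "relu_layer ((\<lambda>i x. x i) ` {..<d}) (card ?I * (0 + 1 + 1)) ?V"
  proof (intro relu_layer_image)
    fix \<iota> assume "\<iota> \<in> ?I"
    then obtain i k s \<sigma> where \<iota>: "\<iota> = ((i, k, s), \<sigma>)" "i < d" by (auto simp: hat_index_def)
    show "affine_in ((\<lambda>i x. x i) ` {..<d}) (0 + 1) (U \<iota>)"
      unfolding \<iota> U_def split using \<iota>(2) by (intro affine_in_add affine_in_const affine_in_base) auto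
  qed simp
  have 2: "relu_layer ?V (card (hat_index d n) * (0 + (1 + 1) + 1)) (hat_features d n)"
  proof -
    define W where "W = (\<lambda>(i, k, s) x. 1 + ((-1) * relu (U ((i, k, s), 1) x) + (-1) * relu (U ((i, k, s), -1) x)))"
    have "(\<lambda>(i, k, s) x. hat k s (x i)) = (\<lambda>\<iota> x. relu (W \<iota> x))"
    proof (intro ext, clarify)
      fix i k s x
      have "\<bar>u\<bar> = relu u + relu (- u)" for u by (simp add: relu_def max_def)
      then have "1 - \<bar>2 ^ Suc k * x i - (2 * real s + 1)\<bar> = W (i, k, s) x"
        by (simp add: W_def U_def algebra_simps)
      then show "hat k s (x i) = relu (W (i, k, s) x)" by (simp add: hat_def)
    qed
    then have eq: "hat_features d n = (\<lambda>\<iota> x. relu (W \<iota> x)) ` hat_index d n"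
      unfolding hat_features_def by simp
    show ?thesis
      unfolding eq
    proof (intro relu_layer_image)
      fix \<iota> assume \<iota>: "\<iota> \<in> hat_index d n"
      obtain i k s where iks: "\<iota> = (i, k, s)" by (cases \<iota>)
      show "affine_in ?V (0 + (1 + 1)) (W \<iota>)"
        unfolding iks W_def split using \<iota> iks
        by (intro affine_in_add affine_in_const affine_in_base) auto
    qed simp
  qed
  have "hidden_features d (Suc (Suc 0)) (hat_features d n)
     (0 + card ?I * (0 + 1 + 1) + card (hat_index d n) * (0 + (1 + 1) + 1))"
    by (rule hidden_features_step[OF hidden_features_step[OF hidden_features_input 1] 2])
      (use ne in \<open>auto simp: hat_features_def\<close>)
  moreover have "0 + card ?I * (0 + 1 + 1) + card (hat_index d n) * (0 + (1 + 1) + 1) \<le> 7 * (d * 2 ^ n)"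
    using card_hat_index[of d n] by (simp add: card_cartesian_product)
  moreover have "Suc (Suc 0) = 2" by simp
  ultimately show ?thesis by (rule hidden_features_mono)
qed

text \<open>The \<open>d * n\<close> sawtooths, each a sum of up to \<open>2 ^ n\<close> hats, cause
  the factor \<open>n + 1\<close>. The constant 1, the empty product, becomes a feature here so that
  the recursion of products can start.\<close>

lemma hidden_base_features:
  assumes "0 < d" "0 < n"
  shows "hidden_features d 3 (base_features d n \<union> prod_features N n 0) (11 * (d * (n + 1) * 2 ^ n))"
proof -
  let ?H = "hat_features d n"
  have keep: "relu_layer ?H (2 * card ?H) ?H"
    by (intro relu_layer_keep) (auto simp: hat_features_def)
  have saw: "relu_layer ?H (card ({..<d} \<times> {..<n}) * (2 ^ n + 1)) (sawtooth_features d n)"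
  proof -
    have "(\<lambda>x. sawtooth k (x i)) = (\<lambda>x. relu (0 + (\<Sum>s<2 ^ k. 1 * hat k s (x i))))" for i k
      by (simp add: sawtooth_def sum_nonneg)
    then have eq: "sawtooth_features d n = (\<lambda>\<iota> x. relu ((\<lambda>(i, k) x. 0 + (\<Sum>s<2 ^ k. 1 * hat k s (x i))) \<iota> x)) ` ({..<d} \<times> {..<n})"
      unfolding sawtooth_features_def by (intro image_cong) auto
    show ?thesis
      unfolding eq
    proof (intro relu_layer_image)
      fix \<iota> assume "\<iota> \<in> {..<d} \<times> {..<n}"
      then obtain i k where \<iota>: "\<iota> = (i, k)" "i < d" "k < n" by auto
      have "affine_in ?H (card {..<(2::nat) ^ k}) (\<lambda>x. 0 + (\<Sum>s<2 ^ k. 1 * hat k s (x i)))"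
      proof (rule affine_in_sum)
        have "(i, k, s) \<in> hat_index d n" if "s < 2 ^ k" for s using \<iota> that by (simp add: hat_index_def)
        then show "(\<lambda>s x. hat k s (x i)) ` {..<2 ^ k} \<subseteq> ?H" unfolding hat_features_def by force
      qed simp
      then show "affine_in ?H (2 ^ n) ((\<lambda>(i, k) x. 0 + (\<Sum>s<2 ^ k. 1 * hat k s (x i))) \<iota>)"
        unfolding \<iota> split using \<iota>(3) by (elim affine_in_mono) (auto intro: power_increasing)
    qed simp
  qed
  have one: "relu_layer ?H (card {()} * (0 + 1)) (prod_features N n 0)"
  proof -
    have "prod_features N n 0 = (\<lambda>_ x. relu 1) ` {()}"
    proof -
      have "level_lists n 0 = {[]}" by (auto simp: level_lists_def)
      then show ?thesis by (simp add: prod_features_def fun_eq_iff)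
    qed
    then show ?thesis using relu_layer_image[of "{()}" ?H 0 "\<lambda>_ _. 1"] affine_in_const by simp
  qed
  let ?T = "2 * card ?H + card ({..<d} \<times> {..<n}) * (2 ^ n + 1) + card {()} * (0 + 1)"
  have "hidden_features d (Suc 2) (base_features d n \<union> prod_features N n 0) (7 * (d * 2 ^ n) + ?T)"
    unfolding base_features_def
    by (rule hidden_features_step[OF hidden_hat_features[OF assms] relu_layer_Un[OF relu_layer_Un[OF keep saw] one]])
      (auto simp: prod_features_def level_lists_def)
  moreover have "7 * (d * 2 ^ n) + ?T \<le> 11 * (d * (n + 1) * 2 ^ n)"
  proof -
    have a: "?T \<le> 2 * (d * 2 ^ n) + d * n * (2 ^ n + 1) + 1"
      using card_hat_features[of d n] by (simp add: card_cartesian_product)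
    have b: "d * n \<le> d * 2 ^ n" by (intro mult_left_mono) (auto intro: less_imp_le)
    have c: "1 \<le> d * 2 ^ n" using assms by simp
    have e1: "d * n * (2 ^ n + 1) = d * n * 2 ^ n + d * n" by (simp add: algebra_simps)
    have e2: "d * (n + 1) * 2 ^ n = d * n * 2 ^ n + d * 2 ^ n" by (simp add: algebra_simps)
    have arith: "7 * D + T \<le> 11 * (X + D)" if "T \<le> 2 * D + (X + Y) + 1" "Y \<le> D" "1 \<le> D" for D T X Y :: nat
      using that by (simp add: algebra_simps)
    show ?thesis unfolding e2 by (rule arith[OF a[unfolded e1] b c])
  qed
  moreover have "Suc 2 = 3" by simp
  ultimately show ?thesis by (rule hidden_features_mono)
qed

section \<open>Layers for approximate products\<close>

text \<open>The hinges of the three squares in \<open>approx_mult\<close>: of the sum, of the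
  sawtooth and of the partial product. Hinges of a single factor are shared by all products in which
  it occurs.\<close>

definition square_features :: "nat \<Rightarrow> nat \<Rightarrow> nat \<Rightarrow> ((nat \<Rightarrow> real) \<Rightarrow> real) set" where
  "square_features N n j =
     (\<lambda>(k, t, r) x. relu (sawtooth k (x j) + approx_saw_prod N t x - real r / real N)) `
       ({..<n} \<times> level_lists n j \<times> {..<2 * N}) \<union>
     ((\<lambda>(k, r) x. relu (sawtooth k (x j) - real r / real N)) ` ({..<n} \<times> {..<2 * N}) \<union>
     (\<lambda>(t, r) x. relu (approx_saw_prod N t x - real r / real N)) ` (level_lists n j \<times> {..<2 * N}))"

text \<open>14 = 6 + 4 + 4: each family has \<open>2 * N\<close> hinges per index, with three
  parameters for a sum of two features and two for a single feature.\<close>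

lemma relu_layer_square_features:
  assumes j: "j < d" and n: "0 < n"
  shows "relu_layer (base_features d n \<union> prod_features N n j) (14 * (n ^ d * N)) (square_features N n j)"
proof -
  let ?F = "base_features d n \<union> prod_features N n j"
  have saw: "affine_in ?F 1 (\<lambda>x. sawtooth k (x j))" if "k < n" for k
    using affine_in_base[of "\<lambda>x. sawtooth k (x j)" ?F 1] sawtooth_in_base[OF j that] by simp
  have pr: "affine_in ?F 1 (\<lambda>x. approx_saw_prod N t x)" if "t \<in> level_lists n j" for t
    using affine_in_base[of "approx_saw_prod N t" ?F 1] that by (simp add: prod_features_def)
  have cst: "affine_in ?F 0 (\<lambda>x. - c)" for c by (rule affine_in_const)
  have 1: "relu_layer ?F (card ({..<n} \<times> level_lists n j \<times> {..<2 * N}) * (1 + 1 + 0 + 1))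
      ((\<lambda>(k, t, r) x. relu (sawtooth k (x j) + approx_saw_prod N t x - real r / real N)) `
       ({..<n} \<times> level_lists n j \<times> {..<2 * N}))"
  proof -
    have "relu_layer ?F (card ({..<n} \<times> level_lists n j \<times> {..<2 * N}) * (1 + 1 + 0 + 1))
      ((\<lambda>\<iota> x. relu ((\<lambda>(k, t, r) x. sawtooth k (x j) + approx_saw_prod N t x + - (real r / real N)) \<iota> x)) `
       ({..<n} \<times> level_lists n j \<times> {..<2 * N}))"
    proof (rule relu_layer_image)
      fix \<iota> assume "\<iota> \<in> {..<n} \<times> level_lists n j \<times> {..<2 * N}"
      then obtain k t r where \<iota>: "\<iota> = (k, t, r)" "k < n" "t \<in> level_lists n j" by auto
      show "affine_in ?F (1 + 1 + 0) ((\<lambda>(k, t, r) x. sawtooth k (x j) + approx_saw_prod N t x + - (real r / real N)) \<iota>)"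
        unfolding \<iota> split by (intro affine_in_add saw pr cst \<iota>)
    qed simp
    then show ?thesis by (simp add: case_prod_beta')
  qed
  have 2: "relu_layer ?F (card ({..<n} \<times> {..<2 * N}) * (1 + 0 + 1))
      ((\<lambda>(k, r) x. relu (sawtooth k (x j) - real r / real N)) ` ({..<n} \<times> {..<2 * N}))"
  proof -
    have "relu_layer ?F (card ({..<n} \<times> {..<2 * N}) * (1 + 0 + 1))
      ((\<lambda>\<iota> x. relu ((\<lambda>(k, r) x. sawtooth k (x j) + - (real r / real N)) \<iota> x)) ` ({..<n} \<times> {..<2 * N}))"
    proof (rule relu_layer_image)
      fix \<iota> assume "\<iota> \<in> {..<n} \<times> {..<2 * N}"
      then obtain k r where \<iota>: "\<iota> = (k, r)" "k < n" by auto
      show "affine_in ?F (1 + 0) ((\<lambda>(k, r) x. sawtooth k (x j) + - (real r / real N)) \<iota>)"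
        unfolding \<iota> split by (intro affine_in_add saw cst \<iota>)
    qed simp
    then show ?thesis by (simp add: case_prod_beta')
  qed
  have 3: "relu_layer ?F (card (level_lists n j \<times> {..<2 * N}) * (1 + 0 + 1))
      ((\<lambda>(t, r) x. relu (approx_saw_prod N t x - real r / real N)) ` (level_lists n j \<times> {..<2 * N}))"
  proof -
    have "relu_layer ?F (card (level_lists n j \<times> {..<2 * N}) * (1 + 0 + 1))
      ((\<lambda>\<iota> x. relu ((\<lambda>(t, r) x. approx_saw_prod N t x + - (real r / real N)) \<iota> x)) ` (level_lists n j \<times> {..<2 * N}))"
    proof (rule relu_layer_image)
      fix \<iota> assume "\<iota> \<in> level_lists n j \<times> {..<2 * N}"
      then obtain t r where \<iota>: "\<iota> = (t, r)" "t \<in> level_lists n j" by auto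
      show "affine_in ?F (1 + 0) ((\<lambda>(t, r) x. approx_saw_prod N t x + - (real r / real N)) \<iota>)"
        unfolding \<iota> split by (intro affine_in_add pr cst \<iota>)
    qed simp
    then show ?thesis by (simp add: case_prod_beta')
  qed
  have "n * n ^ j \<le> n ^ d" using power_increasing[of "Suc j" d n] j n by simp
  moreover have "n \<le> n ^ d" using power_increasing[of 1 d n] j n by simp
  moreover have "n ^ j \<le> n ^ d" using power_increasing[of j d n] j n by simp
  ultimately have "n * n ^ j * N \<le> n ^ d * N" "n * N \<le> n ^ d * N" "n ^ j * N \<le> n ^ d * N"
    by (auto intro: mult_right_mono)
  moreover have "card ({..<n} \<times> level_lists n j \<times> {..<2 * N}) * (1 + 1 + 0 + 1) +
     (card ({..<n} \<times> {..<2 * N}) * (1 + 0 + 1) + card (level_lists n j \<times> {..<2 * N}) * (1 + 0 + 1))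
      = 6 * (n * n ^ j * N) + (4 * (n * N) + 4 * (n ^ j * N))"
    by (simp add: card_cartesian_product card_level_lists)
  ultimately have "card ({..<n} \<times> level_lists n j \<times> {..<2 * N}) * (1 + 1 + 0 + 1) +
     (card ({..<n} \<times> {..<2 * N}) * (1 + 0 + 1) + card (level_lists n j \<times> {..<2 * N}) * (1 + 0 + 1))
      \<le> 14 * (n ^ d * N)" by linarith
  then show ?thesis unfolding square_features_def
    by (rule relu_layer_mono[OF relu_layer_Un[OF 1 relu_layer_Un[OF 2 3]]])
qed

lemma relu_layer_prod_features:
  assumes j: "j < d" and n: "0 < n" and N: "0 < N"
  shows "relu_layer (base_features d n \<union> square_features N n j) (7 * (n ^ d * N)) (prod_features N n (Suc j))"
proof -
  let ?F = "base_features d n \<union> square_features N n j"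
  define W where "W = (\<lambda>(k, t) x. - (1 / (8 * real N ^ 2)) +
     (\<Sum>r<2 * N. (sq_knot_weight N r / 2) * relu (sawtooth k (x j) + approx_saw_prod N t x - real r / real N)) +
     (0 + (\<Sum>r<2 * N. - (sq_knot_weight N r / 2) * relu (sawtooth k (x j) - real r / real N))) +
     (0 + (\<Sum>r<2 * N. - (sq_knot_weight N r / 2) * relu (approx_saw_prod N t x - real r / real N))))"
  have eq: "prod_features N n (Suc j) = (\<lambda>\<iota> x. relu (W \<iota> x)) ` ({..<n} \<times> level_lists n j)"
  proof -
    have "approx_saw_prod N (k # t) = (\<lambda>x. relu (W (k, t) x))" if "t \<in> level_lists n j" for k t
    proof
      fix x
      have len: "length t = j" using that by (simp add: level_lists_def)
      have half: "(\<Sum>r<2 * N. (sq_knot_weight N r / 2) * z r) = (\<Sum>r<2 * N. sq_knot_weight N r * z r) / 2"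
        "(\<Sum>r<2 * N. - (sq_knot_weight N r / 2) * z r) = - ((\<Sum>r<2 * N. sq_knot_weight N r * z r) / 2)" for z
        by (simp_all add: sum_divide_distrib sum_negf)
      show "approx_saw_prod N (k # t) x = relu (W (k, t) x)"
        unfolding W_def split half by (simp add: len approx_mult_def sq_interp_def diff_divide_distrib,
          rule arg_cong[where f = relu], linarith)
    qed
    then show ?thesis unfolding prod_features_def level_lists_Suc image_image by (intro image_cong) auto
  qed
  have "relu_layer ?F (card ({..<n} \<times> level_lists n j) * (2 * N + 2 * N + 2 * N + 1)) (prod_features N n (Suc j))"
    unfolding eq
  proof (rule relu_layer_image)
    fix \<iota> assume "\<iota> \<in> {..<n} \<times> level_lists n j"
    then obtain k t where \<iota>: "\<iota> = (k, t)" "k < n" "t \<in> level_lists n j" by auto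
    have sum: "affine_in ?F (2 * N) (\<lambda>x. b + (\<Sum>r<2 * N. c r * G r x))"
      if "\<And>r. r < 2 * N \<Longrightarrow> G r \<in> square_features N n j" for b c G
      using affine_in_sum[of "{..<2 * N}" G ?F b c] that by auto
    have "(\<lambda>x. relu (sawtooth k (x j) + approx_saw_prod N t x - real r / real N)) \<in> square_features N n j"
      if "r < 2 * N" for r
      unfolding square_features_def
      by (rule UnI1, rule image_eqI[where x = "(k, t, r)"]) (use that \<iota>(2,3) in auto)
    moreover have "(\<lambda>x. relu (sawtooth k (x j) - real r / real N)) \<in> square_features N n j"
      if "r < 2 * N" for r
      unfolding square_features_def
      by (rule UnI2, rule UnI1, rule image_eqI[where x = "(k, r)"]) (use that \<iota>(2) in auto)
    moreover have "(\<lambda>x. relu (approx_saw_prod N t x - real r / real N)) \<in> square_features N n j"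
      if "r < 2 * N" for r
      unfolding square_features_def
      by (rule UnI2, rule UnI2, rule image_eqI[where x = "(t, r)"]) (use that \<iota>(3) in auto)
    ultimately show "affine_in ?F (2 * N + 2 * N + 2 * N) (W \<iota>)"
      unfolding \<iota> W_def split by (intro affine_in_add sum)
  qed simp
  moreover have "card ({..<n} \<times> level_lists n j) * (2 * N + 2 * N + 2 * N + 1) \<le> 7 * (n ^ d * N)"
  proof -
    have "n * n ^ j \<le> n ^ d" using power_increasing[of "Suc j" d n] j n by simp
    then have "n * n ^ j * (2 * N + 2 * N + 2 * N + 1) \<le> n ^ d * (7 * N)"
      using N by (intro mult_mono) auto
    then show ?thesis by (simp add: card_cartesian_product card_level_lists mult_ac)
  qed
  ultimately show ?thesis by (rule relu_layer_mono)
qed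

text \<open>Each factor takes a layer of hinges and a layer of products. They cost
  \<open>14 + 7\<close> times \<open>n ^ d * N\<close>, which is at most \<open>2 ^ n\<close>, and
  twice \<open>4 * d * 2 ^ n\<close> for carrying the base features; hence 29.\<close>

lemma hidden_prod_features:
  assumes d: "0 < d" and n: "0 < n" and N: "0 < N" and le: "n ^ d * N \<le> 2 ^ n" and j: "j \<le> d"
  shows "hidden_features d (3 + 2 * j) (base_features d n \<union> prod_features N n j)
     (11 * (d * (n + 1) * 2 ^ n) + j * (29 * (d * 2 ^ n)))"
  using j
proof (induction j)
  case 0
  then show ?case using hidden_base_features[OF d n] by simp
next
  case (Suc j)
  let ?B = "base_features d n" and ?S = "11 * (d * (n + 1) * 2 ^ n) + j * (29 * (d * 2 ^ n))"
  have keep: "relu_layer (?B \<union> X) (2 * card ?B) ?B" for X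
    by (intro relu_layer_keep base_features_finite base_features_nonneg) auto
  have jd: "j < d" using Suc.prems by simp
  have ne: "?B \<noteq> {}" using sawtooth_in_base[OF d n] by blast
  have "hidden_features d (Suc (3 + 2 * j)) (?B \<union> square_features N n j) (?S + (2 * card ?B + 14 * (n ^ d * N)))"
    by (rule hidden_features_step[OF _ relu_layer_Un[OF keep relu_layer_square_features[OF jd n]]])
      (use Suc ne in auto)
  then have "hidden_features d (Suc (Suc (3 + 2 * j))) (?B \<union> prod_features N n (Suc j))
     (?S + (2 * card ?B + 14 * (n ^ d * N)) + (2 * card ?B + 7 * (n ^ d * N)))"
    by (rule hidden_features_step[OF _ relu_layer_Un[OF keep relu_layer_prod_features[OF jd n N]]]) (use ne in auto)
  moreover have "?S + (2 * card ?B + 14 * (n ^ d * N)) + (2 * card ?B + 7 * (n ^ d * N))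
     \<le> 11 * (d * (n + 1) * 2 ^ n) + Suc j * (29 * (d * 2 ^ n))"
  proof -
    have "n ^ d * N \<le> d * 2 ^ n" using le d by (metis (no_types) One_nat_def Suc_leI le_trans mult.commute mult_le_mono2 mult.right_neutral)
    then show ?thesis using card_base_features[of d n] unfolding mult_Suc by linarith
  qed
  moreover have "Suc (Suc (3 + 2 * j)) = 3 + 2 * Suc j" by simp
  ultimately show ?case by (rule hidden_features_mono)
qed

lemma affine_in_support_gap:
  assumes "\<And>k s. (k, s) \<in> set t \<Longrightarrow> k < n \<and> s < 2 ^ k" "length t \<le> d"
  shows "affine_in (base_features d n) (2 * length t) (\<lambda>x. - support_gap t x)"
  using assms
proof (induction t)
  case Nil
  then show ?case using affine_in_const[of _ 0] by simp
next
  case (Cons a t)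
  obtain k s where a: "a = (k, s)" by (cases a)
  have ks: "k < n" "s < 2 ^ k" using Cons.prems(1)[of k s] a by auto
  have l: "length t < d" using Cons.prems(2) by simp
  have "affine_in (base_features d n) (1 + 1 + 2 * length t)
    (\<lambda>x. (-1) * sawtooth k (x (length t)) + 1 * hat k s (x (length t)) + - support_gap t x)"
    using Cons l ks
    by (intro affine_in_add affine_in_base hat_in_base sawtooth_in_base) auto
  then show ?case using a by (simp add: algebra_simps)
qed

lemma sparse_index_nonempty: "j \<le> n \<Longrightarrow> sparse_index j n \<noteq> {}"
proof (induction j arbitrary: n)
  case (Suc j)
  then obtain t where "t \<in> sparse_index j (n - Suc 0)" by fastforce
  then have "(0, 0) # t \<in> sparse_index (Suc j) n" using Suc.prems by force
  then show ?case by blast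
qed simp

text \<open>Depth: 3 layers up to the sawtooths, 2 for each of the \<open>d\<close> factors, one for
  the localising rectifier, one for the output. A tensor hat costs one weight for its level product,
  \<open>2 * d\<close> for its gap, a bias and an output weight.\<close>

lemma sparse_grid_network:
  assumes d: "2 \<le> d" and dn: "d \<le> n" and N: "0 < N" and le: "n ^ d * N \<le> 2 ^ n"
  shows "\<exists>\<Phi>. is_network d 1 \<Phi> \<and> net_depth \<Phi> = 2 * d + 5 \<and>
    net_size \<Phi> \<le> 47 * d ^ 2 * 2 ^ n * (n + 1) ^ (d - 1) \<and>
    net_fun d \<Phi> = (\<lambda>x. \<Sum>t\<in>sparse_index d n. c t * approx_hat_prod N t x)"
proof -
  let ?I = "sparse_index d n" and ?B = "base_features d n"
  let ?S = "11 * (d * (n + 1) * 2 ^ n) + d * (29 * (d * 2 ^ n))"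
  have d0: "0 < d" and n: "0 < n" using d dn by simp_all
  have pre: "hidden_features d (3 + 2 * d) (?B \<union> prod_features N n d) ?S"
    by (rule hidden_prod_features[OF d0 n N le]) simp
  let ?T = "approx_hat_prod N ` ?I"
  have layer: "relu_layer (?B \<union> prod_features N n d) (card ?I * (1 + 2 * d + 1)) ?T"
  proof -
    have eq: "?T = (\<lambda>t x. relu (1 * approx_saw_prod N (map fst t) x + - support_gap t x)) ` ?I"
      by (intro image_cong) (auto simp: approx_hat_prod_def fun_eq_iff)
    show ?thesis
      unfolding eq
    proof (rule relu_layer_image)
      fix t assume t: "t \<in> ?I"
      have len: "length t = d" using sparse_index_length[OF t] .
      have mem: "k < n \<and> s < 2 ^ k" if "(k, s) \<in> set t" for k s using sparse_index_mem[OF t that] .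
      have "map fst t \<in> level_lists n d" using len mem by (force simp: level_lists_def)
      then have p: "approx_saw_prod N (map fst t) \<in> ?B \<union> prod_features N n d" by (simp add: prod_features_def)
      have "affine_in ?B (2 * length t) (\<lambda>x. - support_gap t x)"
        using mem len by (intro affine_in_support_gap) auto
      then have "affine_in (?B \<union> prod_features N n d) (2 * d) (\<lambda>x. - support_gap t x)"
        by (rule affine_in_mono) (use len in auto)
      then show "affine_in (?B \<union> prod_features N n d) (1 + 2 * d)
         (\<lambda>x. 1 * approx_saw_prod N (map fst t) x + - support_gap t x)"
        by (intro affine_in_add affine_in_base p)
    qed simp
  qed
  have ne: "?T \<noteq> {}" using sparse_index_nonempty[OF dn] by simp
  have out: "affine_in ?T (card ?I) (\<lambda>x. 0 + (\<Sum>t\<in>?I. c t * approx_hat_prod N t x))"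
    by (rule affine_in_sum) auto
  obtain \<Phi> where \<Phi>: "is_network d 1 \<Phi>" "net_depth \<Phi> = Suc (Suc (3 + 2 * d))"
    "net_size \<Phi> \<le> ?S + card ?I * (1 + 2 * d + 1) + card ?I + 1"
    "net_fun d \<Phi> = (\<lambda>x. 0 + (\<Sum>t\<in>?I. c t * approx_hat_prod N t x))"
    using hidden_features_output[OF hidden_features_step[OF pre layer ne] out] by auto
  have "?S + card ?I * (1 + 2 * d + 1) + card ?I + 1 \<le> 47 * d ^ 2 * 2 ^ n * (n + 1) ^ (d - 1)"
  proof -
    define P where "P = 2 ^ n * (n + 1) ^ (d - 1)"
    have I: "card ?I \<le> P" using card_sparse_index[of "d - 1" n] d unfolding P_def by simp
    \<comment> \<open>Here \<open>d \<ge> 2\<close> enters: \<open>(n + 1) ^ (d - 1)\<close> absorbs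
      the factor \<open>n + 1\<close> of the sawtooth layer.\<close>
    have "(n + 1) ^ 1 \<le> (n + 1) ^ (d - 1)" using d by (intro power_increasing) auto
    then have p1: "2 ^ n * (n + 1) \<le> P" unfolding P_def by (intro mult_left_mono) auto
    have p2: "2 ^ n \<le> P" "1 \<le> P" unfolding P_def by auto
    have "?S + card ?I * (1 + 2 * d + 1) + card ?I + 1 = 11 * d * (2 ^ n * (n + 1)) + 29 * (d * d) * 2 ^ n
        + (2 * d + 3) * card ?I + 1" by (simp add: algebra_simps)
    also have "\<dots> \<le> 11 * d * P + 29 * (d * d) * P + (2 * d + 3) * P + P"
      using I p1 p2 by (intro add_mono mult_left_mono) auto
    also have "\<dots> = (13 * d + 29 * (d * d) + 4) * P" by (simp add: algebra_simps)
    also have "\<dots> \<le> (47 * (d * d)) * P"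
    proof (rule mult_right_mono)
      have "2 * d \<le> d * d" using d by simp
      then show "13 * d + 29 * (d * d) + 4 \<le> 47 * (d * d)" using d by linarith
    qed simp
    finally show ?thesis by (simp add: P_def power2_eq_square mult_ac)
  qed
  then show ?thesis using \<Phi> by (intro exI[of _ \<Phi>]) auto
qed

subsection \<open>Essential suprema of continuous functions\<close>

text \<open>Continuity refers to the product topology on all of
  \<open>nat \<Rightarrow> real\<close>, the measure to coordinates below \<open>d\<close>. The
  identity map connects the two: it is measurable because its coordinates are, those outside
  \<open>{..<d}\<close> being constantly \<open>undefined\<close> on the cube.\<close>

lemma cube_measure_measurable:
  assumes "continuous_on (unit_cube d) g"
  shows "g \<in> borel_measurable (cube_measure d)"
proof -
  have space: "space (cube_measure d) = unit_cube d"
    by (simp add: cube_measure_def space_PiM unit_cube_def space_restrict_space)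
  have "(\<lambda>x. x) \<in> measurable (cube_measure d) (borel :: (nat \<Rightarrow> real) measure)"
  proof (rule measurable_coordinatewise_then_product)
    fix i
    show "(\<lambda>x. x i) \<in> borel_measurable (cube_measure d)"
    proof (cases "i < d")
      case True
      have "(\<lambda>x. x i) \<in> measurable (cube_measure d) (restrict_space lborel {0..1::real})"
        unfolding cube_measure_def using True by (intro measurable_component_singleton) auto
      then show ?thesis by (simp add: measurable_restrict_space2_iff)
    next
      case False
      have "(\<lambda>x. x i) \<in> borel_measurable (cube_measure d) \<longleftrightarrow>
          (\<lambda>x. undefined :: real) \<in> borel_measurable (cube_measure d)"
        using False by (intro measurable_cong) (auto simp: space unit_cube_def PiE_iff extensional_def)
      then show ?thesis by simp
    qed
  qed
  then have "(\<lambda>x. x) \<in> measurable (cube_measure d) (restrict_space borel (unit_cube d))"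
    by (intro measurable_restrict_space2) (auto simp: space)
  from measurable_compose[OF this borel_measurable_continuous_on_restrict[OF assms]]
  show ?thesis by simp
qed

lemma Linf_norm_le:
  assumes "continuous_on (unit_cube d) g" "\<And>x. x \<in> unit_cube d \<Longrightarrow> \<bar>g x\<bar> \<le> e"
  shows "Linf_norm d g \<le> ennreal e"
  unfolding Linf_norm_def
proof (rule esssup_I)
  show "(\<lambda>x. ennreal \<bar>g x\<bar>) \<in> borel_measurable (cube_measure d)"
    using cube_measure_measurable[OF assms(1)] by measurable
  have "space (cube_measure d) = unit_cube d"
    by (simp add: cube_measure_def space_PiM unit_cube_def space_restrict_space)
  then show "AE x in cube_measure d. ennreal \<bar>g x\<bar> \<le> ennreal e"
    using assms(2) by (intro AE_I2) (auto intro: ennreal_leI)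
qed

lemma continuous_relu: "continuous_on S f \<Longrightarrow> continuous_on S (\<lambda>x. relu (f x))"
  unfolding relu_def by (intro continuous_intros)

lemma continuous_coordinate: "continuous_on S (\<lambda>x :: nat \<Rightarrow> real. x i)"
  using continuous_on_subset[OF continuous_on_product_coordinates[of i] subset_UNIV] .

lemma continuous_hat: "continuous_on S (\<lambda>x :: nat \<Rightarrow> real. hat k s (x i))"
  unfolding hat_def by (intro continuous_relu continuous_intros continuous_coordinate)

lemma continuous_sawtooth: "continuous_on S (\<lambda>x :: nat \<Rightarrow> real. sawtooth k (x i))"
  unfolding sawtooth_def by (intro continuous_on_sum continuous_hat)

lemma continuous_approx_saw_prod: "continuous_on S (\<lambda>x. approx_saw_prod N t x)"
proof (induction t)
  case (Cons k t)
  then show ?case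
    unfolding approx_saw_prod.simps approx_mult_def sq_interp_def
    by (intro continuous_intros continuous_relu continuous_sawtooth) auto
qed simp

lemma continuous_support_gap: "continuous_on S (\<lambda>x. support_gap t x)"
proof (induction t)
  case (Cons a t)
  then show ?case
    by (cases a) (auto intro!: continuous_intros continuous_sawtooth continuous_hat)
qed simp

lemma continuous_approx_hat_prod: "continuous_on S (\<lambda>x. approx_hat_prod N t x)"
  unfolding approx_hat_prod_def
  by (intro continuous_relu continuous_intros continuous_approx_saw_prod continuous_support_gap)

subsection \<open>Choice of the level\<close>

lemma eventually_at_right_0_threshold:
  assumes "eventually P (at_right (0::real))"
  obtains \<epsilon>0 where "0 < \<epsilon>0" "\<And>\<epsilon>. 0 < \<epsilon> \<Longrightarrow> \<epsilon> < \<epsilon>0 \<Longrightarrow> P \<epsilon>"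
  using assms unfolding eventually_at_right_field by auto

text \<open>The third condition pays for knots and product errors with a quarter of the exponent; by
  the fourth the polynomial factor uses up at most half of the decay. The former is applied at the
  chosen level, the latter one level below.\<close>

lemma level_threshold:
  fixes \<alpha> :: real
  assumes \<alpha>: "0 < \<alpha>"
  obtains n0 where "\<And>m. n0 \<le> m \<Longrightarrow> d \<le> m" "\<And>m. n0 \<le> m \<Longrightarrow> 1 \<le> m"
    "\<And>m. n0 \<le> m \<Longrightarrow> d * m ^ d \<le> 2 ^ (m div 4)"
    "\<And>m. n0 \<le> m \<Longrightarrow> 4 * real (m + 1) ^ (d - 1) \<le> 2 powr (\<alpha> * real m / 2)"
proof -
  have "\<forall>\<^sub>F m in sequentially. real d * real m ^ d \<le> 2 powr (real m / 4 - 1)"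
    by real_asymp
  moreover have "\<forall>\<^sub>F m in sequentially. 4 * real (m + 1) ^ (d - 1) \<le> 2 powr (\<alpha> * real m / 2)"
    using \<alpha> by real_asymp
  moreover have "\<forall>\<^sub>F m in sequentially. max d 1 \<le> m" by (rule eventually_ge_at_top)
  ultimately have "\<forall>\<^sub>F m in sequentially. max d 1 \<le> m \<and> real d * real m ^ d \<le> 2 powr (real m / 4 - 1) \<and>
      4 * real (m + 1) ^ (d - 1) \<le> 2 powr (\<alpha> * real m / 2)" by eventually_elim auto
  then obtain n0 where n0: "\<And>m. n0 \<le> m \<Longrightarrow> max d 1 \<le> m \<and> real d * real m ^ d \<le> 2 powr (real m / 4 - 1) \<and>
      4 * real (m + 1) ^ (d - 1) \<le> 2 powr (\<alpha> * real m / 2)"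
    unfolding eventually_sequentially by blast
  have "d * m ^ d \<le> 2 ^ (m div 4)" if "n0 \<le> m" for m
  proof -
    have "real m / 4 - 1 \<le> real (m div 4)" by linarith
    then have "2 powr (real m / 4 - 1) \<le> (2::real) powr real (m div 4)" by (intro powr_mono) auto
    then have "real (d * m ^ d) \<le> real (2 ^ (m div 4))" using n0[OF that] by (simp add: powr_realpow)
    then show ?thesis by (simp only: of_nat_le_iff)
  qed
  then show thesis using that[of n0] n0 by auto
qed

text \<open>\<open>n\<close> is the least level of sufficient accuracy; the last inequality is the
  failure of level \<open>n - 1\<close>.\<close>

lemma level_choice:
  fixes \<alpha> :: real
  assumes \<alpha>: "0 < \<alpha>" and d: "0 < d"
  shows "\<forall>\<^sub>F \<epsilon> in at_right 0. \<exists>n. n0 < n \<and>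
    2 * 2 powr (- \<alpha> * real n) * real (n + 1) ^ (d - 1) \<le> \<epsilon> \<and>
    \<epsilon> < 2 * 2 powr (- \<alpha> * real (n - 1)) * real n ^ (d - 1)"
proof -
  define h where "h m = 2 * 2 powr (- \<alpha> * real m) * real (m + 1) ^ (d - 1)" for m
  have pos: "0 < h m" for m unfolding h_def by (intro mult_pos_pos zero_less_power) auto
  have lim: "h \<longlonglongrightarrow> 0" unfolding h_def using \<alpha> by real_asymp
  \<comment> \<open>The error bound \<open>h\<close> need not decrease at small levels, so
    \<open>\<epsilon>\<close> is taken below all its values up to \<open>n0\<close> to force
    \<open>n0 < n\<close>.\<close>
  define e where "e = Min (h ` {..n0})"
  have e: "0 < e" unfolding e_def using pos by (subst Min_gr_iff) auto
  have "\<forall>\<^sub>F \<epsilon> in at_right 0. 0 < \<epsilon> \<and> \<epsilon> < e"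
    unfolding eventually_at_right_field using e by auto
  then show ?thesis
  proof eventually_elim
    case (elim \<epsilon>)
    define n where "n = (LEAST m. h m \<le> \<epsilon>)"
    have "\<forall>\<^sub>F m in sequentially. h m < \<epsilon>" using order_tendstoD(2)[OF lim] elim by auto
    then obtain m where "h m \<le> \<epsilon>" by (auto simp: eventually_sequentially intro: less_imp_le)
    then have n: "h n \<le> \<epsilon>" unfolding n_def by (rule LeastI)
    have "n0 < n"
    proof (rule ccontr)
      assume "\<not> n0 < n"
      then have "e \<le> h n" unfolding e_def by (intro Min_le) auto
      then show False using n elim by simp
    qed
    moreover have "\<epsilon> < h (n - 1)"
    proof -
      have "n - 1 < n" using \<open>n0 < n\<close> by simp
      then have "\<not> h (n - 1) \<le> \<epsilon>" unfolding n_def by (rule not_less_Least)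
      then show ?thesis by simp
    qed
    ultimately show ?case using n unfolding h_def by (intro exI[of _ n]) simp
  qed
qed

text \<open>The failure of level \<open>n - 1\<close> is used twice. Together with \<open>gr\<close>
  it gives \<open>2 powr (\<alpha> * (n - 1) / 2) < 1 / \<epsilon>\<close>, so \<open>n\<close> is
  at most of order \<open>log 2 (2 / \<epsilon>) / \<alpha>\<close>; used directly it bounds
  \<open>2 ^ n\<close> by \<open>(4 * (n + 1) ^ (d - 1) / \<epsilon>) powr (1 / \<alpha>)\<close>.
  In the exponent \<open>1 + 1 / \<alpha>\<close> the 1 comes from the number of hats, the rest from
  this bound.\<close>

lemma level_size_bound:
  fixes \<alpha> \<epsilon> :: real
  assumes \<alpha>: "0 < \<alpha>" "\<alpha> \<le> 1" and d: "0 < d" and n: "2 \<le> n" and \<epsilon>: "0 < \<epsilon>" "\<epsilon> \<le> 1"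
    and up: "\<epsilon> < 2 * 2 powr (- \<alpha> * real (n - 1)) * real n ^ (d - 1)"
    and gr: "4 * real n ^ (d - 1) \<le> 2 powr (\<alpha> * real (n - 1) / 2)"
  shows "2 ^ n * real (n + 1) ^ (d - 1) \<le>
    4 powr (1 / \<alpha>) * (8 / \<alpha>) powr ((1 + 1 / \<alpha>) * (real d - 1)) *
    \<epsilon> powr (- (1 / \<alpha>)) * log 2 (2 / \<epsilon>) powr ((1 + 1 / \<alpha>) * (real d - 1))"
proof -
  define m where "m = n - 1"
  have nm: "real n = real m + 1" and m: "1 \<le> m" using n by (auto simp: m_def of_nat_diff)
  define P where "P = real n ^ (d - 1)"
  have P: "1 \<le> P" unfolding P_def using n by simp
  have c: "2 powr (\<alpha> * real m) < 2 * P / \<epsilon>"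
  proof -
    have "\<epsilon> * 2 powr (\<alpha> * real m) < 2 * 2 powr (- \<alpha> * real m) * P * 2 powr (\<alpha> * real m)"
      using up by (intro mult_strict_right_mono) (auto simp: m_def P_def)
    also have "\<dots> = 2 * P" by (simp add: powr_minus field_simps)
    finally show ?thesis using \<epsilon> by (simp add: field_simps)
  qed
  have half: "2 powr (\<alpha> * real m / 2) < 1 / \<epsilon>"
  proof -
    have "2 powr (\<alpha> * real m) = 2 powr (\<alpha> * real m / 2) * 2 powr (\<alpha> * real m / 2)"
      by (simp flip: powr_add)
    then have "2 powr (\<alpha> * real m / 2) * 2 powr (\<alpha> * real m / 2) < 2 * P / \<epsilon>" using c by simp
    moreover have "2 powr (\<alpha> * real m / 2) * (2 * P) \<le> 2 powr (\<alpha> * real m / 2) * 2 powr (\<alpha> * real m / 2)"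
      using gr P by (intro mult_left_mono) (auto simp: P_def m_def)
    ultimately have "2 powr (\<alpha> * real m / 2) * (2 * P) < 2 * P / \<epsilon>" by (rule le_less_trans[rotated])
    then have "2 powr (\<alpha> * real m / 2) * (2 * P) < (1 / \<epsilon>) * (2 * P)" by simp
    then show ?thesis using P by (subst (asm) mult_less_cancel_right_pos) auto
  qed
  define L where "L = log 2 (2 / \<epsilon>)"
  have mL: "\<alpha> * real m / 2 \<le> L"
  proof -
    have "\<alpha> * real m / 2 = log 2 (2 powr (\<alpha> * real m / 2))" by simp
    also have "\<dots> \<le> log 2 (2 / \<epsilon>)" using half \<epsilon> by (subst log_le_cancel_iff) (auto simp: field_simps)
    finally show ?thesis by (simp add: L_def)
  qed
  \<comment> \<open>\<open>n + 1 = m + 2 \<le> 4 * m\<close> and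
    \<open>\<alpha> * m / 2 \<le> L\<close> together produce \<open>8 / \<alpha>\<close>.\<close>
  have nL: "real (n + 1) \<le> (8 / \<alpha>) * L"
  proof -
    have "real (n + 1) \<le> 4 * real m" using nm m by simp
    also have "4 * real m \<le> (8 / \<alpha>) * L" using mL \<alpha> by (simp add: field_simps)
    finally show ?thesis .
  qed
  have two: "2 ^ n \<le> 4 powr (1 / \<alpha>) * \<epsilon> powr (- (1 / \<alpha>)) * real (n + 1) powr ((real d - 1) / \<alpha>)"
  proof -
    have "2 powr (\<alpha> * real n) = 2 powr (\<alpha> * real m) * 2 powr \<alpha>" by (simp add: nm powr_add algebra_simps)
    also have "\<dots> \<le> (2 * P / \<epsilon>) * 2 powr 1" using c \<alpha> \<epsilon> P by (intro mult_mono powr_mono) auto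
    also have "\<dots> \<le> 4 * (1 / \<epsilon>) * real (n + 1) ^ (d - 1)"
      unfolding P_def using \<epsilon> by (simp add: field_simps power_mono)
    finally have "(2 powr (\<alpha> * real n)) powr (1 / \<alpha>) \<le> (4 * (1 / \<epsilon>) * real (n + 1) ^ (d - 1)) powr (1 / \<alpha>)"
      using \<alpha> by (intro powr_mono2) auto
    moreover have "(2 powr (\<alpha> * real n)) powr (1 / \<alpha>) = 2 ^ n"
      using \<alpha> by (simp add: powr_powr powr_realpow)
    moreover have "(4 * (1 / \<epsilon>) * real (n + 1) ^ (d - 1)) powr (1 / \<alpha>) =
        4 powr (1 / \<alpha>) * \<epsilon> powr (- (1 / \<alpha>)) * real (n + 1) powr ((real d - 1) / \<alpha>)"
    proof -
      have "real (n + 1) ^ (d - 1) = real (n + 1) powr (real d - 1)"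
        using d by (subst powr_realpow[symmetric]) (auto simp: of_nat_diff)
      then have "(real (n + 1) ^ (d - 1)) powr (1 / \<alpha>) = real (n + 1) powr ((real d - 1) / \<alpha>)"
        by (simp add: powr_powr)
      moreover have "(1 / \<epsilon>) powr (1 / \<alpha>) = \<epsilon> powr (- (1 / \<alpha>))"
        using \<epsilon> by (simp add: powr_divide powr_minus_divide)
      ultimately show ?thesis using \<epsilon> by (simp only: powr_mult)
    qed
    ultimately show ?thesis by simp
  qed
  have "2 ^ n * real (n + 1) ^ (d - 1) \<le>
     4 powr (1 / \<alpha>) * \<epsilon> powr (- (1 / \<alpha>)) * real (n + 1) powr ((real d - 1) / \<alpha>) * real (n + 1) powr (real d - 1)"
  proof -
    have "real (n + 1) ^ (d - 1) = real (n + 1) powr (real d - 1)"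
      using d by (subst powr_realpow[symmetric]) (auto simp: of_nat_diff)
    then show ?thesis using two by (simp add: mult_right_mono)
  qed
  also have "\<dots> = 4 powr (1 / \<alpha>) * \<epsilon> powr (- (1 / \<alpha>)) * real (n + 1) powr ((1 + 1 / \<alpha>) * (real d - 1))"
  proof -
    have "(real d - 1) / \<alpha> + (real d - 1) = (1 + 1 / \<alpha>) * (real d - 1)"
      using \<alpha> by (simp add: field_simps)
    then show ?thesis by (simp only: mult.assoc powr_add[symmetric])
  qed
  also have "\<dots> \<le> 4 powr (1 / \<alpha>) * \<epsilon> powr (- (1 / \<alpha>)) * ((8 / \<alpha>) * L) powr ((1 + 1 / \<alpha>) * (real d - 1))"
    using nL \<alpha> d by (intro mult_left_mono powr_mono2) auto
  also have "\<dots> = 4 powr (1 / \<alpha>) * (8 / \<alpha>) powr ((1 + 1 / \<alpha>) * (real d - 1)) *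
    \<epsilon> powr (- (1 / \<alpha>)) * L powr ((1 + 1 / \<alpha>) * (real d - 1))"
    by (simp only: powr_mult mult_ac)
  finally show ?thesis unfolding L_def .
qed

section \<open>Assembling the bounds\<close>

lemma holder_ball0_network:
  assumes \<alpha>: "0 < \<alpha>" "\<alpha> \<le> 1" and d: "2 \<le> d" and dn: "d \<le> n"
    and large: "d * n ^ d \<le> 2 ^ (n div 4)" and f: "f \<in> holder_ball0 \<alpha> d"
  shows "\<exists>\<Phi>. is_network d 1 \<Phi> \<and> net_depth \<Phi> = 2 * d + 5 \<and>
    net_size \<Phi> \<le> 47 * d ^ 2 * 2 ^ n * (n + 1) ^ (d - 1) \<and>
    Linf_norm d (\<lambda>x. f x - net_fun d \<Phi> x) \<le> ennreal (2 * 2 powr (- \<alpha> * real n) * real (n + 1) ^ (d - 1))"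
proof -
  \<comment> \<open>About \<open>2 powr (3 * n / 4)\<close>. As
    \<open>n ^ d \<le> 2 ^ (n div 4)\<close>, the knots for all level lists fit into
    \<open>2 ^ n\<close>; and \<open>n + n div 4 \<le> 2 * (n - n div 4)\<close> makes
    \<open>N ^ 2\<close> at least \<open>d * n ^ d * 2 ^ n\<close>.\<close>
  define N :: nat where "N = 2 ^ (n - n div 4)"
  have N: "0 < N" by (simp add: N_def)
  have "n ^ d * N \<le> d * n ^ d * N" using d by simp
  also have "\<dots> \<le> 2 ^ (n div 4) * N" using large by (rule mult_right_mono) simp
  also have "\<dots> = 2 ^ n" by (simp add: N_def flip: power_add)
  finally have le: "n ^ d * N \<le> 2 ^ n" .
  have prod_error: "real d * real n ^ d / real N ^ 2 \<le> 2 powr (- \<alpha> * real n) * real (n + 1) ^ (d - 1)"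
  proof -
    have "d * n ^ d * 2 ^ n \<le> 2 ^ (n div 4) * 2 ^ n" using large by (rule mult_right_mono) simp
    also have "\<dots> = 2 ^ (n div 4 + n)" by (simp add: power_add)
    also have "\<dots> \<le> 2 ^ (2 * (n - n div 4))" by (intro power_increasing) auto
    also have "\<dots> = N ^ 2" unfolding N_def by (simp add: mult.commute flip: power_mult)
    finally have "real (d * n ^ d * 2 ^ n) \<le> real (N ^ 2)" by (rule of_nat_mono)
    then have "real d * real n ^ d / real N ^ 2 \<le> 1 / 2 ^ n" using N by (simp add: field_simps)
    also have "\<dots> = 2 powr - real n" by (rule half_power_eq_powr)
    \<comment> \<open>Here \<open>\<alpha> \<le> 1\<close> enters: the interpolation error dominates
      the product error.\<close>
    also have "\<dots> \<le> 2 powr (- \<alpha> * real n) * 1" using \<alpha> by (simp add: mult_left_le_one_le)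
    also have "\<dots> \<le> 2 powr (- \<alpha> * real n) * real (n + 1) ^ (d - 1)" by (intro mult_left_mono one_le_power) auto
    finally show ?thesis .
  qed
  have d0: "0 < d" using d by simp
  obtain c where c: "\<And>t. t \<in> sparse_index d n \<Longrightarrow> \<bar>c t\<bar> \<le> 1"
    "\<And>x. x \<in> unit_cube d \<Longrightarrow> \<bar>f x - (\<Sum>t\<in>sparse_index d n. c t * hat_prod t x)\<bar>
       \<le> 2 powr (- \<alpha> * real n) * real (n + 1) ^ (d - 1)"
    using holder_ball0_sparse_grid[OF \<alpha>(1) d0 f] by blast
  obtain \<Phi> where \<Phi>: "is_network d 1 \<Phi>" "net_depth \<Phi> = 2 * d + 5"
    "net_size \<Phi> \<le> 47 * d ^ 2 * 2 ^ n * (n + 1) ^ (d - 1)"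
    "net_fun d \<Phi> = (\<lambda>x. \<Sum>t\<in>sparse_index d n. c t * approx_hat_prod N t x)"
    using sparse_grid_network[OF d dn N le, of c] by blast
  have "Linf_norm d (\<lambda>x. f x - net_fun d \<Phi> x) \<le> ennreal (2 * (2 powr (- \<alpha> * real n) * real (n + 1) ^ (d - 1)))"
  proof (rule Linf_norm_le)
    have "continuous_on (unit_cube d) f" using f by (simp add: holder_ball0_def holder_space_def)
    then show "continuous_on (unit_cube d) (\<lambda>x. f x - net_fun d \<Phi> x)"
      unfolding \<Phi>(4) by (intro continuous_intros continuous_approx_hat_prod)
    fix x assume "x \<in> unit_cube d"
    from c(2)[OF this] approx_hat_prod_sum_error[where d = d and n = n and c = c and x = x, OF N c(1)] prod_error
    show "\<bar>f x - net_fun d \<Phi> x\<bar> \<le> 2 * (2 powr (- \<alpha> * real n) * real (n + 1) ^ (d - 1))"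
      unfolding \<Phi>(4) by simp
  qed
  then show ?thesis using \<Phi>(1-3) by (intro exI[of _ \<Phi>]) (simp only: mult.assoc)
qed

lemma K2_const_pos:
  assumes "0 < \<alpha>" "\<alpha> \<le> 1"
  shows "0 < K2_const \<alpha>"
proof -
  have "0 < log 2 (2 * inverse \<alpha>)" using assms by (simp add: field_simps)
  moreover have "1 < 2 powr \<alpha>" using assms by simp
  ultimately have "0 < inverse \<alpha> * log 2 (2 * inverse \<alpha>)" "0 < 2 powr (\<alpha> + 3) * inverse (2 powr \<alpha> - 1)"
    using assms by simp_all
  then have "0 < (inverse \<alpha> * log 2 (2 * inverse \<alpha>)) powr (1 / 2)"
    "0 < (2 powr (\<alpha> + 3) * inverse (2 powr \<alpha> - 1)) powr (1 / (2 * \<alpha> + 2))"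
    by (metis powr_gt_zero less_irrefl)+
  then show ?thesis unfolding K2_const_def B_const_def by (intro mult_pos_pos) auto
qed

theorem theorem5p1:
  shows "\<forall>\<alpha>::real. 0 < \<alpha> \<and> \<alpha> \<le> 1 \<longrightarrow>
    (\<exists>C C'::real. C > 0 \<and> C' > 0 \<and>
      (\<forall>d::nat. d \<ge> 2 \<longrightarrow>
        (\<exists>\<epsilon>0::real. 0 < \<epsilon>0 \<and> \<epsilon>0 \<le> 1 / 2 \<and>
          (\<forall>\<epsilon>::real. 0 < \<epsilon> \<and> \<epsilon> < \<epsilon>0 \<longrightarrow>
            (\<forall>f\<in>holder_ball0 \<alpha> d.
              \<exists>\<Phi>. is_network d 1 \<Phi> \<and> net_deep \<Phi> \<and>
                Linf_norm d (\<lambda>x. f x - net_fun d \<Phi> x) \<le> ennreal \<epsilon> \<and>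
                real (net_size \<Phi>) \<le>
                  C * real d ^ 2 * (K2_const \<alpha> ^ d / fact (d - 1)) powr (2 / \<alpha> + 2) *
                  \<epsilon> powr (- (1 / \<alpha>)) *
                  (log 2 (2 / \<epsilon>) * log 2 (log 2 (2 / \<epsilon>))) powr ((1 + 1 / \<alpha>) * (real d - 1)) \<and>
                real (net_depth \<Phi>) \<le>
                  C' * \<epsilon> powr (- (1 / (real d * \<alpha>))) *
                  log 2 (2 / \<epsilon>) powr ((real d - 1 - \<alpha>) / (real d * \<alpha>)) *
                  log 2 (log 2 (2 / \<epsilon>)) powr ((\<alpha> + 1) * (real d - 1) / (real d * \<alpha>)))))))"
proof (intro allI impI, elim conjE, rule exI[of _ 1], rule exI[of _ 1], intro conjI allI impI)
  fix \<alpha> :: real and d :: nat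
  assume \<alpha>: "0 < \<alpha>" "\<alpha> \<le> 1" and d: "2 \<le> d"
  show "\<exists>\<epsilon>0::real. 0 < \<epsilon>0 \<and> \<epsilon>0 \<le> 1 / 2 \<and>
          (\<forall>\<epsilon>::real. 0 < \<epsilon> \<and> \<epsilon> < \<epsilon>0 \<longrightarrow>
            (\<forall>f\<in>holder_ball0 \<alpha> d.
              \<exists>\<Phi>. is_network d 1 \<Phi> \<and> net_deep \<Phi> \<and>
                Linf_norm d (\<lambda>x. f x - net_fun d \<Phi> x) \<le> ennreal \<epsilon> \<and>
                real (net_size \<Phi>) \<le>
                  1 * real d ^ 2 * (K2_const \<alpha> ^ d / fact (d - 1)) powr (2 / \<alpha> + 2) *
                  \<epsilon> powr (- (1 / \<alpha>)) *
                  (log 2 (2 / \<epsilon>) * log 2 (log 2 (2 / \<epsilon>))) powr ((1 + 1 / \<alpha>) * (real d - 1)) \<and>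
                real (net_depth \<Phi>) \<le>
                  1 * \<epsilon> powr (- (1 / (real d * \<alpha>))) *
                  log 2 (2 / \<epsilon>) powr ((real d - 1 - \<alpha>) / (real d * \<alpha>)) *
                  log 2 (log 2 (2 / \<epsilon>)) powr ((\<alpha> + 1) * (real d - 1) / (real d * \<alpha>))))"
  proof -
    define \<beta> where "\<beta> = (1 + 1 / \<alpha>) * (real d - 1)"
    define b where "b = 1 / (real d * \<alpha>)"
    have \<beta>: "0 < \<beta>" and b: "0 < b" unfolding \<beta>_def b_def using \<alpha> d by (auto intro!: mult_pos_pos add_pos_pos)
    \<comment> \<open>\<open>D\<close> is the factor of the admissible size that is fixed by
      \<open>d\<close> and \<open>\<alpha>\<close>, \<open>K\<close> below the one attained.
      \<open>D\<close> may be tiny because of the factorial, but only its positivity counts, as the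
      threshold for \<open>\<epsilon>\<close> may depend on \<open>d\<close>.\<close>
    define D where "D = real d ^ 2 * (K2_const \<alpha> ^ d / fact (d - 1)) powr (2 / \<alpha> + 2)"
    have D: "0 < D" unfolding D_def using K2_const_pos[OF \<alpha>] d by simp
    define K where "K = 47 * real d ^ 2 * (4 powr (1 / \<alpha>) * (8 / \<alpha>) powr \<beta>)"
    obtain n0 where n0: "\<And>m. n0 \<le> m \<Longrightarrow> d \<le> m" "\<And>m. n0 \<le> m \<Longrightarrow> 1 \<le> m"
      "\<And>m. n0 \<le> m \<Longrightarrow> d * m ^ d \<le> 2 ^ (m div 4)"
      "\<And>m. n0 \<le> m \<Longrightarrow> 4 * real (m + 1) ^ (d - 1) \<le> 2 powr (\<alpha> * real m / 2)"
      using level_threshold[OF \<alpha>(1)] by metis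
    have "\<forall>\<^sub>F \<epsilon> in at_right 0. \<epsilon> \<le> (1 / 2 :: real)" unfolding eventually_at_right_field by (intro exI[of _ "1/2"]) auto
    moreover have "\<forall>\<^sub>F \<epsilon> in at_right 0. 1 \<le> log 2 (log 2 (2 / \<epsilon>))" by real_asymp
    moreover have "\<forall>\<^sub>F \<epsilon> in at_right 0. 1 \<le> log 2 (2 / \<epsilon>)" by real_asymp
    \<comment> \<open>Since \<open>\<beta>\<close> is positive, this power of the iterated logarithm
      outgrows \<open>K / D\<close>.\<close>
    moreover have "\<forall>\<^sub>F \<epsilon> in at_right 0. K / D \<le> log 2 (log 2 (2 / \<epsilon>)) powr \<beta>"
    proof -
      have "filterlim (\<lambda>\<epsilon>. log 2 (log 2 (2 / \<epsilon>)) powr \<beta>) at_top (at_right (0::real))"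
        using \<beta> by real_asymp
      then show ?thesis by (simp add: filterlim_at_top)
    qed
    \<comment> \<open>The depth does not grow as \<open>\<epsilon>\<close> decreases, so the power
      of \<open>\<epsilon>\<close> alone eventually exceeds it.\<close>
    moreover have "\<forall>\<^sub>F \<epsilon> in at_right 0. real (2 * d + 5) \<le> \<epsilon> powr (- b)"
    proof -
      have "filterlim (\<lambda>\<epsilon>. \<epsilon> powr (- b)) at_top (at_right (0::real))"
        using b by real_asymp
      then show ?thesis by (simp only: filterlim_at_top)
    qed
    moreover note level_choice[OF \<alpha>(1), of d n0]
    ultimately have "\<forall>\<^sub>F \<epsilon> in at_right 0. \<epsilon> \<le> 1 / 2 \<and> 1 \<le> log 2 (log 2 (2 / \<epsilon>)) \<and> 1 \<le> log 2 (2 / \<epsilon>) \<and>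
        K / D \<le> log 2 (log 2 (2 / \<epsilon>)) powr \<beta> \<and> real (2 * d + 5) \<le> \<epsilon> powr (- b) \<and>
        (\<exists>n. n0 < n \<and> 2 * 2 powr (- \<alpha> * real n) * real (n + 1) ^ (d - 1) \<le> \<epsilon> \<and>
          \<epsilon> < 2 * 2 powr (- \<alpha> * real (n - 1)) * real n ^ (d - 1))"
      using d by (intro eventually_conj) auto
    then obtain e where e: "0 < e" and small: "\<And>\<epsilon>. 0 < \<epsilon> \<Longrightarrow> \<epsilon> < e \<Longrightarrow>
        \<epsilon> \<le> 1 / 2 \<and> 1 \<le> log 2 (log 2 (2 / \<epsilon>)) \<and> 1 \<le> log 2 (2 / \<epsilon>) \<and>
        K / D \<le> log 2 (log 2 (2 / \<epsilon>)) powr \<beta> \<and> real (2 * d + 5) \<le> \<epsilon> powr (- b) \<and>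
        (\<exists>n. n0 < n \<and> 2 * 2 powr (- \<alpha> * real n) * real (n + 1) ^ (d - 1) \<le> \<epsilon> \<and>
          \<epsilon> < 2 * 2 powr (- \<alpha> * real (n - 1)) * real n ^ (d - 1))"
      by (rule eventually_at_right_0_threshold) blast
    show ?thesis
    proof (intro exI[of _ "min e (1 / 2)"] conjI allI impI ballI; (elim conjE)?)
      fix \<epsilon> f
      assume \<epsilon>: "0 < \<epsilon>" "\<epsilon> < min e (1 / 2)" and f: "f \<in> holder_ball0 \<alpha> d"
      define L where "L = log 2 (2 / \<epsilon>)"
      define LL where "LL = log 2 L"
      have L: "1 \<le> L" "1 \<le> LL" "K / D \<le> LL powr \<beta>" and depth: "real (2 * d + 5) \<le> \<epsilon> powr (- b)"
        using small[of \<epsilon>] \<epsilon> by (auto simp: L_def LL_def)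
      obtain n where n: "n0 < n" "2 * 2 powr (- \<alpha> * real n) * real (n + 1) ^ (d - 1) \<le> \<epsilon>"
          "\<epsilon> < 2 * 2 powr (- \<alpha> * real (n - 1)) * real n ^ (d - 1)"
        using small[of \<epsilon>] \<epsilon> by auto
      \<comment> \<open>Being strictly above \<open>n0\<close> makes the thresholds available at
        \<open>n\<close> and also at \<open>n - 1\<close>, the level where accuracy fails.\<close>
      have "n0 \<le> n" "n0 \<le> n - 1" using n(1) by auto
      note n_large = n0(1,3)[OF this(1)] n0(2,4)[OF this(2)]
      have n2: "2 \<le> n" using n_large(3) by linarith
      obtain \<Phi> where \<Phi>: "is_network d 1 \<Phi>" "net_depth \<Phi> = 2 * d + 5"
        "net_size \<Phi> \<le> 47 * d ^ 2 * 2 ^ n * (n + 1) ^ (d - 1)"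
        "Linf_norm d (\<lambda>x. f x - net_fun d \<Phi> x) \<le> ennreal (2 * 2 powr (- \<alpha> * real n) * real (n + 1) ^ (d - 1))"
        using holder_ball0_network[OF \<alpha> d n_large(1,2) f] by blast
      have size: "real (net_size \<Phi>) \<le> D * \<epsilon> powr (- (1 / \<alpha>)) * (L * LL) powr \<beta>"
      proof -
        have "real (net_size \<Phi>) \<le> real (47 * d ^ 2 * 2 ^ n * (n + 1) ^ (d - 1))"
          using \<Phi>(3) by (rule of_nat_mono)
        also have "\<dots> = 47 * real d ^ 2 * (2 ^ n * real (n + 1) ^ (d - 1))" by (simp add: mult.assoc)
        also have "\<dots> \<le> 47 * real d ^ 2 * (4 powr (1 / \<alpha>) * (8 / \<alpha>) powr \<beta> * \<epsilon> powr (- (1 / \<alpha>)) * L powr \<beta>)"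
          unfolding \<beta>_def L_def
          using n n2 n_large(4) \<epsilon> d \<alpha> by (intro mult_left_mono level_size_bound) (auto simp: nat_less_le)
        also have "\<dots> = K * (\<epsilon> powr (- (1 / \<alpha>)) * L powr \<beta>)" by (simp only: K_def mult.assoc)
        also have "\<dots> \<le> (D * LL powr \<beta>) * (\<epsilon> powr (- (1 / \<alpha>)) * L powr \<beta>)"
          using L(3) D by (intro mult_right_mono) (auto simp: field_simps)
        also have "\<dots> = D * \<epsilon> powr (- (1 / \<alpha>)) * (L * LL) powr \<beta>"
          by (simp only: powr_mult mult_ac)
        finally show ?thesis .
      qed
      have depth': "real (net_depth \<Phi>) \<le> \<epsilon> powr (- b) * L powr ((real d - 1 - \<alpha>) / (real d * \<alpha>)) *
          LL powr ((\<alpha> + 1) * (real d - 1) / (real d * \<alpha>))"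
      proof -
        \<comment> \<open>The exponent is nonnegative because
          \<open>d - 1 \<ge> 1 \<ge> \<alpha>\<close>, so the logarithm only enlarges the depth
          bound.\<close>
        have "1 \<le> L powr ((real d - 1 - \<alpha>) / (real d * \<alpha>))"
          using L(1) \<alpha> d by (intro ge_one_powr_ge_zero divide_nonneg_nonneg) auto
        moreover have "1 \<le> LL powr ((\<alpha> + 1) * (real d - 1) / (real d * \<alpha>))"
          using L(2) \<alpha> d by (intro ge_one_powr_ge_zero divide_nonneg_nonneg mult_nonneg_nonneg) auto
        ultimately have "\<epsilon> powr (- b) * 1 * 1 \<le> \<epsilon> powr (- b) * L powr ((real d - 1 - \<alpha>) / (real d * \<alpha>)) *
          LL powr ((\<alpha> + 1) * (real d - 1) / (real d * \<alpha>))" by (intro mult_mono) auto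
        then show ?thesis using depth \<Phi>(2) by simp
      qed
      have "Linf_norm d (\<lambda>x. f x - net_fun d \<Phi> x) \<le> ennreal \<epsilon>"
        using \<Phi>(4) ennreal_leI[OF n(2)] by (rule order_trans)
      moreover have "net_deep \<Phi>" using \<Phi>(2) by (simp add: net_deep_def)
      ultimately show "\<exists>\<Phi>. is_network d 1 \<Phi> \<and> net_deep \<Phi> \<and>
                Linf_norm d (\<lambda>x. f x - net_fun d \<Phi> x) \<le> ennreal \<epsilon> \<and>
                real (net_size \<Phi>) \<le>
                  1 * real d ^ 2 * (K2_const \<alpha> ^ d / fact (d - 1)) powr (2 / \<alpha> + 2) *
                  \<epsilon> powr (- (1 / \<alpha>)) *
                  (log 2 (2 / \<epsilon>) * log 2 (log 2 (2 / \<epsilon>))) powr ((1 + 1 / \<alpha>) * (real d - 1)) \<and>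
                real (net_depth \<Phi>) \<le>
                  1 * \<epsilon> powr (- (1 / (real d * \<alpha>))) *
                  log 2 (2 / \<epsilon>) powr ((real d - 1 - \<alpha>) / (real d * \<alpha>)) *
                  log 2 (log 2 (2 / \<epsilon>)) powr ((\<alpha> + 1) * (real d - 1) / (real d * \<alpha>))"
        using \<Phi>(1) size depth' unfolding D_def \<beta>_def b_def L_def LL_def mult_1 by blast
    qed (use e in auto)
  qed
qed simp_all

end
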